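(* Consider the triggered urn model described in the context and suppose there is $p<1$ with $p_n\le p$ for all $n\ge1$. Let $C_\infty=\sup_n C_n$ be the total number of colors ever observed. (1) If $\sum_{n=1}^\infty 1/F(n)<\infty$, then almost surely exactly one color is observed infinitely many times, all other colors being observed a finite number of times. (2) If $\sum_{n=1}^\infty 1/F(n)=\infty$, then almost surely every observed color is observed infinitely often, i.e. $K_{n,c}\uparrow\infty$ as $n\to\infty$ for every color $c$ with $1\le c\le C_\infty$.
   Context: Triggered (FAQ) urn model. The urn is empty at time $0$. Let $B_0=1$ and let $(B_n)_{n\ge1}$ be independent Bernoulli random variables with $\Pr(B_n=1)=p_n\in(0,1)$, independent of everything else in the construction. Let $F:[1,\infty)\to[0,\infty)$ be strictly increasing with $F(1)>0$ (the update function). Colors are labelled $1,2,\dots$ in order of first appearance, and a history sequence $\mathcal S=(S_n)_{n\ge1}$ records one color per time step. For a color $c$, $K_{n,c}$ denotes the number of times $c$ has been registered in $\mathcal S$ up to and including time $n$; at time $n$ the urn contains, for each color $c$ already present, a weight $F(K_{n,c})$. At each time $n\ge1$: if $B_{n-1}=1$, a new color is added with weight $F(1)$ and registered in $\mathcal S$; if $B_{n-1}=0$, a color $c$ among those present is drawn with probability $F(K_{n-1,c})/\sum_{c'}F(K_{n-1,c'})$ (sum over colors present at time $n-1$), registered in $\mathcal S$, and its weight becomes $F(K_{n,c})$. $C_n=\sum_{i=0}^{n-1}B_i$ is the number of distinct colors present at time $n$. *)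

theory Defs
  imports "HOL-Probability.Probability"
begin

text \<open>Finite-history description of the triggered (FAQ) urn.
  A history of the registered colours S_1,...,S_n is a list h (h!i = S_{i+1}).
  Colours are labelled 1,2,... in order of first appearance.\<close>

definition hist_count :: "nat list \<Rightarrow> nat \<Rightarrow> nat" where
  "hist_count h c = length (filter (\<lambda>x. x = c) h)"

text \<open>Probability that the next registered colour is c, given the trigger bit b
  (= B_n) and the history h = [S_1,...,S_n].\<close>
definition urn_step :: "(real \<Rightarrow> real) \<Rightarrow> bool \<Rightarrow> nat list \<Rightarrow> nat \<Rightarrow> real" where
  "urn_step F b h c =
     (if b then (if c = card (set h) + 1 then 1 else 0)
      else (if c \<in> set h
            then F (real (hist_count h c)) / (\<Sum>c'\<in>set h. F (real (hist_count h c')))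
            else 0))"

definition bern :: "real \<Rightarrow> bool \<Rightarrow> real" where
  "bern q b = (if b then q else 1 - q)"

text \<open>Joint probability that (B_0,...,B_n) = bs and (S_1,...,S_n) = ss,
  where length bs = n+1 and length ss = n.\<close>
definition urn_prob :: "(nat \<Rightarrow> real) \<Rightarrow> (real \<Rightarrow> real) \<Rightarrow> bool list \<Rightarrow> nat list \<Rightarrow> real" where
  "urn_prob p F bs ss =
     (if bs ! 0 then 1 else 0)
     * (\<Prod>i\<in>{1..length ss}. bern (p i) (bs ! i))
     * (\<Prod>i<length ss. urn_step F (bs ! i) (take i ss) (ss ! i))"

definition urn_K :: "(nat \<Rightarrow> 'a \<Rightarrow> nat) \<Rightarrow> nat \<Rightarrow> nat \<Rightarrow> 'a \<Rightarrow> nat" where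
  "urn_K S n c \<omega> = card {i\<in>{1..n}. S i \<omega> = c}"

text \<open>C_n = B_0 + ... + B_{n-1}: number of colours present at time n.\<close>
definition urn_C :: "(nat \<Rightarrow> 'a \<Rightarrow> bool) \<Rightarrow> nat \<Rightarrow> 'a \<Rightarrow> nat" where
  "urn_C B n \<omega> = card {i\<in>{0..<n}. B i \<omega>}"

end

theory Submission
  imports Defs
begin

text \<open>
  Write \<open>W\<^sub>n\<close> for the total weight at time \<open>n\<close> and \<open>f\<^sub>k = F(k)\<close>. The sum of the \<open>1 / W\<^sub>n\<close> plays
  the role of continuous time in Rubin's exponential embedding: on this clock a colour with
  count \<open>k\<close> waits an exponential time of rate \<open>f\<^sub>k\<close>. Everything is done with explicit
  (super)martingales that are products over the counts.

  \<^emph>\<open>At most one.\<close> If \<open>\<Sum> 1/f\<^sub>k\<close> converges and \<open>\<Phi>\<^sub>\<theta>(k) = \<Prod>\<^bsub>j<k\<^esub> (1 - \<i> \<theta>/f\<^sub>j)\<close>, then for two colours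
  \<open>\<Phi>\<^sub>\<theta>(K\<^sub>c)\<close> times the conjugate of \<open>\<Phi>\<^sub>\<theta>(K\<^sub>d)\<close> is a bounded martingale. Divided by its maximal modulus it
  starts at a value tending to 0 as \<open>\<theta> \<rightarrow> \<infinity>\<close>, its limit is 1 when both counts
  diverge and tends to 0 otherwise. So both counts diverge with probability 0.

  \<^emph>\<open>At least one.\<close> Let \<open>f\<^sub>j \<ge> a j\<close> and suppose that the clock stays bounded. Every new colour is
  assigned a boss, the leading colour at its birth. The harmonic functions
  \<open>\<Prod>(1 + \<lambda>/f\<^sub>j) \<Prod>(1 - \<lambda>/f\<^sub>j)\<close> of the counts of a colour and its boss, with \<open>\<lambda>\<close> of the order of the
  square root of the boss's count at birth, bound the probability of overtaking the boss. Their
  initial values are summable in the count of the boss, whence a suitable weighted sum over all colours is a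
  nonnegative supermartingale: the cost of new colours is paid for by the draws of colours with a
  large count, which carry most of the weight because \<open>W\<^sub>n / n \<rightarrow> \<infinity>\<close>. By Fatou's lemma only finitely
  many colours end up ahead of their boss. If all counts were finite they would therefore be
  bounded and \<open>W\<^sub>n\<close> would grow at most linearly, so the clock would diverge.

  \<^emph>\<open>Divergent case.\<close> If \<open>\<Sum> 1/f\<^sub>k\<close> diverges, then on a bounded clock all counts are bounded, which the
  preceding argument excludes if \<open>f\<^sub>j \<ge> a j\<close>; otherwise \<open>f\<^sub>j\<close> is small compared with \<open>j\<close> for
  suitable \<open>j\<close> and no colour reaches level \<open>j\<close> before the clock has become large. So the clock
  diverges, and a colour whose count has stopped would have been drawn again.
\<close>

section \<open>Histories and their law\<close>

lemma hist_count_snoc [simp]: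
  "hist_count (h @ [x]) c = (if x = c then Suc (hist_count h c) else hist_count h c)"
  by (simp add: hist_count_def)

lemma hist_count_Nil [simp]: "hist_count [] c = 0"
  by (simp add: hist_count_def)

lemma hist_count_eq_0_iff: "hist_count h c = 0 \<longleftrightarrow> c \<notin> set h"
  by (auto simp: hist_count_def filter_empty_conv)

lemma hist_count_pos_iff: "0 < hist_count h c \<longleftrightarrow> c \<in> set h"
  using hist_count_eq_0_iff[of h c] by auto

text \<open>A new colour always takes the next free label, so only finitely many histories of each
  length can occur. Expectations of functions of the history thus become finite sums over this
  set.\<close>

fun hists :: "nat \<Rightarrow> nat list set" where
  "hists 0 = {[]}"
| "hists (Suc n) = (\<Union>h\<in>hists n. (\<lambda>c. h @ [c]) ` {1..Suc (card (set h))})"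

lemma finite_hists [simp]: "finite (hists n)"
  by (induction n) auto

lemma length_hists: "h \<in> hists n \<Longrightarrow> length h = n"
  by (induction n arbitrary: h) auto

lemma set_hists: "h \<in> hists n \<Longrightarrow> set h = {1..card (set h)}"
proof (induction n arbitrary: h)
  case (Suc n)
  then obtain g c where g: "g \<in> hists n" and c: "c \<in> {1..Suc (card (set g))}" and h: "h = g @ [c]"
    by auto
  have sg: "set g = {1..card (set g)}" using Suc.IH[OF g] .
  show ?case
  proof (cases "c = Suc (card (set g))")
    case True
    then have "set h = {1..Suc (card (set g))}"
      using sg h by (auto simp: atLeastAtMostSuc_conv)
    then show ?thesis by simp
  next
    case False
    then have "c \<in> set g" using c sg by (metis atLeastAtMost_iff le_SucE)
    then have "set h = set g" using h by auto
    then show ?thesis using sg by simp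
  qed
qed simp

lemma hists_snoc_iff:
  "h @ [c] \<in> hists (Suc n) \<longleftrightarrow> h \<in> hists n \<and> 1 \<le> c \<and> c \<le> Suc (card (set h))"
  by (auto simp: image_iff)

lemma new_notin_hists: "h \<in> hists n \<Longrightarrow> Suc (card (set h)) \<notin> set h"
  using set_hists by (metis atLeastAtMost_iff not_less_eq_eq order_refl)

lemma card_set_hists_le: "h \<in> hists n \<Longrightarrow> card (set h) \<le> n"
  using card_length length_hists by metis

lemma hist_count_le_length: "hist_count h c \<le> length h"
  by (simp add: hist_count_def)

text \<open>The trigger bits can be read off the history: \<open>B i\<close> is set exactly when the
  entry at index i is new. This carries the law of pairs of bits and colours over to histories
  alone.\<close>

definition fresh_bits :: "nat list \<Rightarrow> bool list" where
  "fresh_bits h = map (\<lambda>i. h ! i \<notin> set (take i h)) [0..<length h]"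

lemma length_fresh_bits [simp]: "length (fresh_bits h) = length h"
  by (simp add: fresh_bits_def)

lemma fresh_bits_snoc: "fresh_bits (h @ [c]) = fresh_bits h @ [c \<notin> set h]"
  by (simp add: fresh_bits_def nth_append)

text \<open>Mind the offset: the colour c is decided by the last bit of \<open>bs\<close>, while the
  added bit b enters only through its own Bernoulli factor and acts on the colour after c.\<close>

lemma urn_prob_snoc:
  assumes bs: "length bs = Suc (length h)"
  shows "urn_prob p F (bs @ [b]) (h @ [c])
    = urn_prob p F bs h * urn_step F (bs ! length h) h c * bern (p (Suc (length h))) b"
proof -
  let ?n = "length h"
  have "(\<Prod>i\<in>{1..Suc ?n}. bern (p i) ((bs @ [b]) ! i))
      = (\<Prod>i\<in>{1..?n}. bern (p i) ((bs @ [b]) ! i)) * bern (p (Suc ?n)) b"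
    using bs by (simp add: nth_append)
  also have "(\<Prod>i\<in>{1..?n}. bern (p i) ((bs @ [b]) ! i)) = (\<Prod>i\<in>{1..?n}. bern (p i) (bs ! i))"
    using bs by (intro prod.cong) (auto simp: nth_append)
  finally have 1: "(\<Prod>i\<in>{1..Suc ?n}. bern (p i) ((bs @ [b]) ! i))
      = (\<Prod>i\<in>{1..?n}. bern (p i) (bs ! i)) * bern (p (Suc ?n)) b" .
  have "(\<Prod>i<Suc ?n. urn_step F ((bs @ [b]) ! i) (take i (h @ [c])) ((h @ [c]) ! i))
     = (\<Prod>i<?n. urn_step F ((bs @ [b]) ! i) (take i (h @ [c])) ((h @ [c]) ! i)) * urn_step F (bs ! ?n) h c"
    using bs by (simp add: nth_append)
  also have "(\<Prod>i<?n. urn_step F ((bs @ [b]) ! i) (take i (h @ [c])) ((h @ [c]) ! i))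
     = (\<Prod>i<?n. urn_step F (bs ! i) (take i h) (h ! i))"
    using bs by (intro prod.cong) (auto simp: nth_append)
  finally have 2: "(\<Prod>i<Suc ?n. urn_step F ((bs @ [b]) ! i) (take i (h @ [c])) ((h @ [c]) ! i))
     = (\<Prod>i<?n. urn_step F (bs ! i) (take i h) (h ! i)) * urn_step F (bs ! ?n) h c" .
  have 3: "(bs @ [b]) ! 0 = bs ! 0" using bs by (simp add: nth_append)
  show ?thesis
    unfolding urn_prob_def length_append_singleton 1 2 3 by (simp only: mult_ac)
qed

section \<open>The setting, and consistency of almost every path\<close>

locale faq_urn = prob_space M for M :: "'a measure" +
  fixes B :: "nat \<Rightarrow> 'a \<Rightarrow> bool"
    and S :: "nat \<Rightarrow> 'a \<Rightarrow> nat"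
    and p :: "nat \<Rightarrow> real"
    and F :: "real \<Rightarrow> real"
    and q :: real
  assumes B_meas: "\<And>n. B n \<in> measurable M (count_space UNIV)"
    and S_meas: "\<And>n. S n \<in> measurable M (count_space UNIV)"
    and p_range: "\<And>n. n \<ge> 1 \<Longrightarrow> 0 < p n \<and> p n < 1"
    and q_lt1: "q < 1"
    and p_le_q: "\<And>n. n \<ge> 1 \<Longrightarrow> p n \<le> q"
    and F_mono: "strict_mono_on {1..} F"
    and F1: "F 1 > 0"
    and law: "\<And>n bs ss. length bs = Suc n \<Longrightarrow> length ss = n \<Longrightarrow>
       measure M {\<omega>\<in>space M. (\<forall>i\<le>n. B i \<omega> = bs ! i) \<and> (\<forall>i<n. S (Suc i) \<omega> = ss ! i)}
         = urn_prob p F bs ss"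
begin

declare B_meas [measurable] S_meas [measurable]

lemma sets_bits_colours [measurable]:
  "{\<omega>\<in>space M. (\<forall>i\<le>n. B i \<omega> = bs ! i) \<and> (\<forall>i<n. S (Suc i) \<omega> = ss ! i)} \<in> sets M"
  by measurable

definition wt :: "nat \<Rightarrow> real" where "wt k = F (real k)"

definition W :: "nat list \<Rightarrow> real" where
  "W h = (\<Sum>c\<in>set h. wt (hist_count h c))"

definition hist :: "nat \<Rightarrow> 'a \<Rightarrow> nat list" where
  "hist n \<omega> = map (\<lambda>i. S (Suc i) \<omega>) [0..<n]"

lemma wt_mono: "1 \<le> i \<Longrightarrow> i \<le> j \<Longrightarrow> wt i \<le> wt j"
  using strict_mono_onD[OF F_mono, of "real i" "real j"] unfolding wt_def
  by (cases "i = j") (auto simp: less_imp_le)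

lemma wt_pos: "1 \<le> i \<Longrightarrow> 0 < wt i"
  using wt_mono[of 1 i] F1 by (simp add: wt_def)

lemma wt_count_pos: "c \<in> set h \<Longrightarrow> 0 < wt (hist_count h c)"
  using hist_count_pos_iff[of h c] by (intro wt_pos) simp

lemma W_pos: "h \<noteq> [] \<Longrightarrow> 0 < W h"
  unfolding W_def by (intro sum_pos) (auto simp: wt_count_pos)

lemma hist_0 [simp]: "hist 0 \<omega> = []"
  by (simp add: hist_def)

lemma hist_Suc: "hist (Suc n) \<omega> = hist n \<omega> @ [S (Suc n) \<omega>]"
  by (simp add: hist_def)

lemma length_hist [simp]: "length (hist n \<omega>) = n"
  by (simp add: hist_def)

lemma take_hist: "m \<le> n \<Longrightarrow> take m (hist n \<omega>) = hist m \<omega>"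
  by (simp add: hist_def take_map)

lemma hist_eq_iff: "length h = n \<Longrightarrow> hist n \<omega> = h \<longleftrightarrow> (\<forall>i<n. S (Suc i) \<omega> = h ! i)"
  by (auto simp: hist_def list_eq_iff_nth_eq)

lemma hist_meas [measurable]: "hist n \<in> measurable M (count_space UNIV)"
proof (subst measurable_count_space_eq2_countable, safe)
  fix h :: "nat list"
  show "hist n -` {h} \<inter> space M \<in> sets M"
  proof (cases "length h = n")
    case True
    then have "hist n -` {h} \<inter> space M = {\<omega>\<in>space M. \<forall>i<n. S (Suc i) \<omega> = h ! i}"
      using hist_eq_iff by auto
    then show ?thesis by simp
  next
    case False
    then have "hist n -` {h} \<inter> space M = {}" by auto
    then show ?thesis by simp
  qed
qed auto

text \<open>There are only countably many pairs of finite lists, so all cylinders of probability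
  zero can be discarded together.\<close>

lemma AE_consistent:
  "AE \<omega> in M. \<forall>n. urn_prob p F (map (\<lambda>i. B i \<omega>) [0..<Suc n]) (hist n \<omega>) \<noteq> 0"
proof -
  define E where "E bs ss = {\<omega>\<in>space M. (\<forall>i\<le>length ss. B i \<omega> = bs ! i) \<and> (\<forall>i<length ss. S (Suc i) \<omega> = ss ! i)}"
    for bs ss
  have E: "AE \<omega> in M. length bs = Suc (length ss) \<longrightarrow> urn_prob p F bs ss = 0 \<longrightarrow> \<omega> \<notin> E bs ss" for bs ss
  proof (cases "length bs = Suc (length ss) \<and> urn_prob p F bs ss = 0")
    case True
    have "E bs ss \<in> sets M" unfolding E_def by (rule sets_bits_colours)
    moreover have "measure M (E bs ss) = 0"
      using law[of bs "length ss" ss] True unfolding E_def by simp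
    ultimately have "E bs ss \<in> null_sets M" by (simp add: emeasure_eq_measure null_sets_def)
    from AE_not_in[OF this] show ?thesis by eventually_elim simp
  next
    case False
    then show ?thesis by (intro AE_I2) blast
  qed
  have "AE \<omega> in M. \<forall>bs ss. length bs = Suc (length ss) \<longrightarrow> urn_prob p F bs ss = 0 \<longrightarrow> \<omega> \<notin> E bs ss"
    unfolding AE_all_countable using E by blast
  then show ?thesis
    using AE_space
  proof eventually_elim
    case (elim \<omega>)
    have "\<omega> \<in> E (map (\<lambda>i. B i \<omega>) [0..<Suc n]) (hist n \<omega>)" for n
      using elim(2) unfolding E_def by (auto simp: hist_def simp del: upt_Suc)
    moreover have "length (map (\<lambda>i. B i \<omega>) [0..<Suc n]) = Suc (length (hist n \<omega>))" for n
      by simp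
    ultimately show ?case using elim(1) by blast
  qed
qed

text \<open>If all cylinders along a path have nonzero probability, every factor
  \<open>urn_step\<close> is nonzero. That forces consecutive labels and ties the trigger bit to the
  novelty of the next colour.\<close>

lemma AE_hist: "AE \<omega> in M. \<forall>n. hist n \<omega> \<in> hists n \<and> (B n \<omega> \<longleftrightarrow> S (Suc n) \<omega> \<notin> set (hist n \<omega>))"
  using AE_consistent
proof eventually_elim
  case (elim \<omega>)
  have st: "urn_step F (B n \<omega>) (hist n \<omega>) (S (Suc n) \<omega>) \<noteq> 0" for n
  proof -
    have "(\<Prod>i<Suc n. urn_step F (map (\<lambda>i. B i \<omega>) [0..<Suc (Suc n)] ! i)
        (take i (hist (Suc n) \<omega>)) (hist (Suc n) \<omega> ! i)) \<noteq> 0"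
      using elim[rule_format, of "Suc n"] by (auto simp: urn_prob_def simp del: upt_Suc)
    then have "urn_step F (map (\<lambda>i. B i \<omega>) [0..<Suc (Suc n)] ! n)
        (take n (hist (Suc n) \<omega>)) (hist (Suc n) \<omega> ! n) \<noteq> 0"
      by (subst (asm) prod_zero_iff) (auto simp del: upt_Suc)
    then show ?thesis
      by (simp add: take_hist hist_def nth_append del: upt_Suc)
        (simp add: hist_def[symmetric] nth_append)
  qed
  have "hist n \<omega> \<in> hists n" for n
  proof (induction n)
    case (Suc n)
    have "S (Suc n) \<omega> = Suc (card (set (hist n \<omega>))) \<or> S (Suc n) \<omega> \<in> set (hist n \<omega>)"
      using st[of n] by (auto simp: urn_step_def split: if_splits)
    moreover have "1 \<le> c \<and> c \<le> card (set (hist n \<omega>))" if "c \<in> set (hist n \<omega>)" for c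
      using that by (subst (asm) set_hists[OF Suc]) simp
    ultimately have "1 \<le> S (Suc n) \<omega>" "S (Suc n) \<omega> \<le> Suc (card (set (hist n \<omega>)))"
      by (force, force)
    then show ?case
      unfolding hist_Suc hists_snoc_iff using Suc by blast
  qed simp
  moreover have "B n \<omega> \<longleftrightarrow> S (Suc n) \<omega> \<notin> set (hist n \<omega>)" if "hist n \<omega> \<in> hists n" for n
    using st[of n] new_notin_hists[OF that] by (auto simp: urn_step_def split: if_splits)
  ultimately show ?case by blast
qed

lemma AE_hist_in: "AE \<omega> in M. \<forall>n. hist n \<omega> \<in> hists n"
  using AE_hist by eventually_elim auto

section \<open>Transition probabilities of the history and the one-step operator\<close>

definition bit_prob :: "nat \<Rightarrow> bool \<Rightarrow> real" where
  "bit_prob n b = (if n = 0 then (if b then 1 else 0) else bern (p n) b)"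

definition hprob :: "nat list \<Rightarrow> real" where
  "hprob h = measure M {\<omega>\<in>space M. hist (length h) \<omega> = h}"

text \<open>Almost surely the earlier bits are functions of the history, so prescribing the history
  and \<open>B n\<close> amounts to a full cylinder, whose measure is given by
  \<open>law\<close>.\<close>

lemma measure_hist_bit:
  assumes h: "h \<in> hists n"
  shows "measure M {\<omega>\<in>space M. hist n \<omega> = h \<and> B n \<omega> = b} = urn_prob p F (fresh_bits h @ [b]) h"
proof -
  have len: "length h = n" using length_hists[OF h] .
  let ?A = "{\<omega>\<in>space M. hist n \<omega> = h \<and> B n \<omega> = b}"
  let ?C = "{\<omega>\<in>space M. (\<forall>i\<le>n. B i \<omega> = (fresh_bits h @ [b]) ! i) \<and> (\<forall>i<n. S (Suc i) \<omega> = h ! i)}"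
  have "measure M ?A = measure M ?C"
  proof (rule finite_measure_eq_AE)
    show "?A \<in> sets M" by measurable
    show "?C \<in> sets M" by (rule sets_bits_colours)
    show "AE x in M. (x \<in> ?A) = (x \<in> ?C)"
      using AE_hist
    proof eventually_elim
      case (elim \<omega>)
      have "B i \<omega> = (fresh_bits h @ [b]) ! i" if "hist n \<omega> = h" "i < n" for i
      proof -
        have "B i \<omega> \<longleftrightarrow> S (Suc i) \<omega> \<notin> set (hist i \<omega>)" using elim by blast
        moreover have "hist i \<omega> = take i h" using that take_hist[of i n \<omega>] by simp
        moreover have "S (Suc i) \<omega> = h ! i" using that len hist_eq_iff by blast
        ultimately show ?thesis using that len by (simp add: nth_append fresh_bits_def)
      qed
      moreover have "(fresh_bits h @ [b]) ! n = b" using len by (simp add: nth_append)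
      ultimately show ?case using hist_eq_iff[OF len, of \<omega>]
        by (auto simp: le_less)
    qed
  qed
  then show ?thesis using law[of "fresh_bits h @ [b]" n h] len by simp
qed

lemma hprob_eq_sum_bits:
  assumes h: "h \<in> hists n"
  shows "hprob h = urn_prob p F (fresh_bits h @ [True]) h + urn_prob p F (fresh_bits h @ [False]) h"
proof -
  have len: "length h = n" using length_hists[OF h] .
  define A where "A b = {\<omega>\<in>space M. hist n \<omega> = h \<and> B n \<omega> = b}" for b
  have A: "A b \<in> sets M" for b unfolding A_def by measurable
  have "hprob h = measure M (A True \<union> A False)"
    unfolding hprob_def len A_def by (intro arg_cong[where f="measure M"]) auto
  also have "\<dots> = measure M (A True) + measure M (A False)"
    using A by (intro finite_measure_Union) (auto simp: A_def)
  finally show ?thesis unfolding A_def measure_hist_bit[OF h] .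
qed

text \<open>Independence of \<open>B n\<close> from the history: its Bernoulli factor splits off,
  and what remains is \<open>hprob h\<close> because the probabilities of the two bits add up to 1.
  At time 0 the bit is deterministic.\<close>

lemma urn_prob_bit:
  assumes h: "h \<in> hists n"
  shows "urn_prob p F (fresh_bits h @ [b]) h = hprob h * bit_prob n b"
proof (cases n)
  case 0
  then have "h = []" using h by simp
  then show ?thesis using hprob_eq_sum_bits[OF h] 0
    by (simp add: urn_prob_def bit_prob_def fresh_bits_def)
next
  case (Suc m)
  then obtain g c where g: "g \<in> hists m" "h = g @ [c]" using h by auto
  have len: "length g = m" using length_hists[OF g(1)] .
  define X where "X = urn_prob p F (fresh_bits h) g * urn_step F (fresh_bits h ! m) g c"
  have X: "urn_prob p F (fresh_bits h @ [b]) h = X * bern (p n) b" for b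
    unfolding X_def g(2) Suc using urn_prob_snoc[of "fresh_bits (g @ [c])" g p F b c] len by simp
  have "hprob h = X" using hprob_eq_sum_bits[OF h] unfolding X by (simp add: bern_def algebra_simps)
  then show ?thesis using X Suc by (simp add: bit_prob_def)
qed

lemma hprob_snoc:
  assumes h: "h \<in> hists n" and c: "1 \<le> c" "c \<le> Suc (card (set h))"
  shows "hprob (h @ [c]) = hprob h * (bit_prob n (c \<notin> set h) * urn_step F (c \<notin> set h) h c)"
proof -
  have len: "length h = n" using length_hists[OF h] .
  have hc: "h @ [c] \<in> hists (Suc n)" unfolding hists_snoc_iff using h c by blast
  have *: "urn_prob p F (fresh_bits (h @ [c]) @ [b]) (h @ [c])
     = urn_prob p F (fresh_bits h @ [c \<notin> set h]) h * urn_step F (c \<notin> set h) h c * bern (p (Suc n)) b" for b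
    unfolding fresh_bits_snoc using urn_prob_snoc[of "fresh_bits h @ [c \<notin> set h]" h p F b c] len
    by (simp add: nth_append)
  have "hprob (h @ [c]) = urn_prob p F (fresh_bits h @ [c \<notin> set h]) h * urn_step F (c \<notin> set h) h c"
    unfolding hprob_eq_sum_bits[OF hc] * by (simp add: bern_def algebra_simps)
  then show ?thesis unfolding urn_prob_bit[OF h] by (simp only: mult.assoc)
qed

text \<open>Values lie in a general Banach space, so that the same formula serves the real
  supermartingales and the complex martingale.\<close>

lemma integral_hist:
  fixes f :: "nat list \<Rightarrow> 'b::{banach, second_countable_topology}"
  shows "integrable M (\<lambda>\<omega>. f (hist n \<omega>))" (is ?int)
    and "(\<integral>\<omega>. f (hist n \<omega>) \<partial>M) = (\<Sum>h\<in>hists n. hprob h *\<^sub>R f h)" (is ?eq)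
proof -
  let ?A = "\<lambda>h. {\<omega>\<in>space M. hist n \<omega> = h}"
  have ae: "AE \<omega> in M. f (hist n \<omega>) = (\<Sum>h\<in>hists n. indicator (?A h) \<omega> *\<^sub>R f h)"
    using AE_hist_in AE_space
  proof eventually_elim
    case (elim \<omega>)
    have "(\<Sum>h\<in>hists n. indicator (?A h) \<omega> *\<^sub>R f h) = (\<Sum>h\<in>hists n. if h = hist n \<omega> then f h else 0)"
      using elim by (intro sum.cong) (auto simp: indicator_def)
    then show ?case using elim by simp
  qed
  have bi: "has_bochner_integral M (\<lambda>\<omega>. \<Sum>h\<in>hists n. indicator (?A h) \<omega> *\<^sub>R f h)
      (\<Sum>h\<in>hists n. measure M (?A h) *\<^sub>R f h)"
    by (intro has_bochner_integral_sum has_bochner_integral_scaleR_left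
        has_bochner_integral_real_indicator) (auto simp: emeasure_eq_measure)
  have m: "(\<lambda>\<omega>. f (hist n \<omega>)) \<in> borel_measurable M"
    by (rule measurable_compose[OF hist_meas]) simp
  have "has_bochner_integral M (\<lambda>\<omega>. f (hist n \<omega>)) (\<Sum>h\<in>hists n. measure M (?A h) *\<^sub>R f h)"
    using bi ae m has_bochner_integralI_AE
    by (subst has_bochner_integral_cong_AE[OF m _ ae]) auto
  moreover have "(\<Sum>h\<in>hists n. measure M (?A h) *\<^sub>R f h) = (\<Sum>h\<in>hists n. hprob h *\<^sub>R f h)"
    by (intro sum.cong) (auto simp: hprob_def length_hists)
  ultimately show ?int ?eq by (auto simp: has_bochner_integral_iff)
qed

text \<open>For nonempty h this is the conditional expectation of f at the next history given h. The
  empty history is different, as the first trigger bit is certain and \<open>p 0\<close> carries no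
  meaning.\<close>

definition step :: "(nat list \<Rightarrow> 'b::real_vector) \<Rightarrow> nat list \<Rightarrow> 'b" where
  "step f h = p (length h) *\<^sub>R f (h @ [Suc (card (set h))])
     + (1 - p (length h)) *\<^sub>R (\<Sum>c\<in>set h. (wt (hist_count h c) / W h) *\<^sub>R f (h @ [c]))"

text \<open>Takes the place of conditional expectations: martingale and supermartingale properties
  become the pointwise statements \<open>step f h = f h\<close> and
  \<open>step f h \<le> f h\<close> on \<open>hists n\<close>.\<close>

lemma integral_hist_Suc:
  fixes f :: "nat list \<Rightarrow> 'b::{banach, second_countable_topology}"
  assumes n: "1 \<le> n"
  shows "(\<integral>\<omega>. f (hist (Suc n) \<omega>) \<partial>M) = (\<integral>\<omega>. step f (hist n \<omega>) \<partial>M)"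
proof -
  have "(\<integral>\<omega>. f (hist (Suc n) \<omega>) \<partial>M) = (\<Sum>h\<in>hists (Suc n). hprob h *\<^sub>R f h)"
    by (rule integral_hist)
  also have "\<dots> = (\<Sum>h\<in>hists n. \<Sum>g\<in>(\<lambda>c. h @ [c]) ` {1..Suc (card (set h))}. hprob g *\<^sub>R f g)"
    unfolding hists.simps by (subst sum.UNION_disjoint) auto
  also have "\<dots> = (\<Sum>h\<in>hists n. \<Sum>c\<in>{1..Suc (card (set h))}. hprob (h @ [c]) *\<^sub>R f (h @ [c]))"
    by (intro sum.cong refl, subst sum.reindex) (auto simp: inj_on_def)
  also have "\<dots> = (\<Sum>h\<in>hists n. hprob h *\<^sub>R step f h)"
  proof (intro sum.cong refl)
    fix h assume h: "h \<in> hists n"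
    have len: "length h = n" using length_hists[OF h] .
    have set: "{1..Suc (card (set h))} = insert (Suc (card (set h))) (set h)"
      using set_hists[OF h] by (metis atLeastAtMostSuc_conv le_add1 plus_1_eq_Suc)
    have "(\<Sum>c\<in>{1..Suc (card (set h))}. hprob (h @ [c]) *\<^sub>R f (h @ [c]))
       = (\<Sum>c\<in>{1..Suc (card (set h))}. (hprob h * (bit_prob n (c \<notin> set h) * urn_step F (c \<notin> set h) h c)) *\<^sub>R f (h @ [c]))"
      using hprob_snoc[OF h] by (intro sum.cong) auto
    also have "\<dots> = hprob h *\<^sub>R (\<Sum>c\<in>{1..Suc (card (set h))}. (bit_prob n (c \<notin> set h) * urn_step F (c \<notin> set h) h c) *\<^sub>R f (h @ [c]))"
      by (simp only: scaleR_right.sum scaleR_scaleR)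
    also have "(\<Sum>c\<in>{1..Suc (card (set h))}. (bit_prob n (c \<notin> set h) * urn_step F (c \<notin> set h) h c) *\<^sub>R f (h @ [c])) = step f h"
      unfolding set step_def scaleR_right.sum using new_notin_hists[OF h] n len
      by (subst sum.insert)
        (auto simp: bit_prob_def bern_def urn_step_def W_def wt_def intro!: sum.cong arg_cong2[where f="(+)"])
    finally show "(\<Sum>c\<in>{1..Suc (card (set h))}. hprob (h @ [c]) *\<^sub>R f (h @ [c])) = hprob h *\<^sub>R step f h" .
  qed
  also have "\<dots> = (\<integral>\<omega>. step f (hist n \<omega>) \<partial>M)"
    by (rule integral_hist(2)[symmetric])
  finally show ?thesis .
qed

lemma hprob_nonneg: "0 \<le> hprob h"
  by (simp add: hprob_def)

lemma integral_hist_mono: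
  fixes f g :: "nat list \<Rightarrow> real"
  assumes "\<And>h. h \<in> hists n \<Longrightarrow> f h \<le> g h"
  shows "(\<integral>\<omega>. f (hist n \<omega>) \<partial>M) \<le> (\<integral>\<omega>. g (hist n \<omega>) \<partial>M)"
  unfolding integral_hist using assms by (auto intro!: sum_mono mult_left_mono hprob_nonneg)

lemma integral_hist_cong:
  fixes f g :: "nat list \<Rightarrow> 'b::{banach, second_countable_topology}"
  assumes "\<And>h. h \<in> hists n \<Longrightarrow> f h = g h"
  shows "(\<integral>\<omega>. f (hist n \<omega>) \<partial>M) = (\<integral>\<omega>. g (hist n \<omega>) \<partial>M)"
  unfolding integral_hist using assms by (auto intro!: sum.cong)

section \<open>Single colours and the clock\<close>

lemma W_nonneg: "0 \<le> W h"
  unfolding W_def by (intro sum_nonneg) (auto intro: less_imp_le wt_count_pos)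

lemma W_snoc:
  "W (h @ [c]) = W h + (if c \<in> set h then wt (Suc (hist_count h c)) - wt (hist_count h c) else wt 1)"
proof (cases "c \<in> set h")
  case True
  have "W (h @ [c]) = (\<Sum>x\<in>set h. wt (if x = c then Suc (hist_count h x) else hist_count h x))"
    unfolding W_def using True by (intro sum.cong) (auto simp: insert_absorb)
  also have "\<dots> = W h + (\<Sum>x\<in>set h. if x = c then wt (Suc (hist_count h c)) - wt (hist_count h c) else 0)"
    unfolding W_def sum.distrib[symmetric] by (intro sum.cong) auto
  finally show ?thesis using True by simp
next
  case False
  have "W (h @ [c]) = wt (Suc (hist_count h c)) + (\<Sum>x\<in>set h. wt (hist_count (h @ [c]) x))"
    unfolding W_def using False by simp
  also have "(\<Sum>x\<in>set h. wt (hist_count (h @ [c]) x)) = W h"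
    unfolding W_def using False by (intro sum.cong) auto
  finally show ?thesis using False hist_count_eq_0_iff[of h c] by simp
qed

lemma W_mono_snoc: "W h \<le> W (h @ [c])"
  using wt_mono[of "hist_count h c" "Suc (hist_count h c)"] wt_pos[of 1] hist_count_pos_iff[of h c]
  by (auto simp: W_snoc)

lemma W_hist_mono: "m \<le> n \<Longrightarrow> W (hist m \<omega>) \<le> W (hist n \<omega>)"
  by (rule lift_Suc_mono_le[of "\<lambda>n. W (hist n \<omega>)"]) (auto simp: hist_Suc W_mono_snoc)

lemma hist_count_hist_mono: "m \<le> n \<Longrightarrow> hist_count (hist m \<omega>) c \<le> hist_count (hist n \<omega>) c"
  by (rule lift_Suc_mono_le[of "\<lambda>n. hist_count (hist n \<omega>) c"]) (auto simp: hist_Suc)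

lemma sum_weights: "h \<noteq> [] \<Longrightarrow> (\<Sum>c\<in>set h. wt (hist_count h c) / W h) = 1"
  using W_pos[of h] by (simp add: sum_divide_distrib[symmetric] W_def[symmetric])

lemma step_diff:
  assumes "h \<noteq> []"
  shows "step f h - f h = p (length h) *\<^sub>R (f (h @ [Suc (card (set h))]) - f h)
    + (1 - p (length h)) *\<^sub>R (\<Sum>c\<in>set h. (wt (hist_count h c) / W h) *\<^sub>R (f (h @ [c]) - f h))"
proof -
  have "(\<Sum>c\<in>set h. (wt (hist_count h c) / W h) *\<^sub>R f h) = f h"
    unfolding scaleR_left.sum[symmetric] sum_weights[OF assms] by simp
  then show ?thesis
    unfolding step_def scaleR_right_diff_distrib sum_subtractf
    by (simp add: algebra_simps)
qed

text \<open>Besides draws of c, only its birth could move the count, from 0 to 1. The condition on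
  \<phi> makes that move invisible or excludes it.\<close>

lemma step_count:
  fixes \<phi> :: "nat \<Rightarrow> real"
  assumes h: "h \<in> hists n" "1 \<le> n" and \<phi>: "\<phi> 0 = \<phi> 1 \<or> c \<in> set h"
  shows "step (\<lambda>g. \<phi> (hist_count g c)) h = \<phi> (hist_count h c)
    + (1 - p n) * (if c \<in> set h then wt (hist_count h c) / W h * (\<phi> (Suc (hist_count h c)) - \<phi> (hist_count h c)) else 0)"
proof -
  have len: "length h = n" and ne: "h \<noteq> []" using length_hists[OF h(1)] h(2) by auto
  have new: "\<phi> (hist_count (h @ [Suc (card (set h))]) c) = \<phi> (hist_count h c)"
    using \<phi> new_notin_hists[OF h(1)] hist_count_eq_0_iff[of h c] by auto
  have "(\<Sum>x\<in>set h. (wt (hist_count h x) / W h) *\<^sub>R (\<phi> (hist_count (h @ [x]) c) - \<phi> (hist_count h c)))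
     = (\<Sum>x\<in>set h. if x = c then wt (hist_count h c) / W h * (\<phi> (Suc (hist_count h c)) - \<phi> (hist_count h c)) else 0)"
    by (intro sum.cong) auto
  then show ?thesis
    using step_diff[OF ne, of "\<lambda>g. \<phi> (hist_count g c)"] len new by simp
qed

lemma p_bounds: "1 \<le> n \<Longrightarrow> 0 < p n" "1 \<le> n \<Longrightarrow> p n < 1" "1 \<le> n \<Longrightarrow> 1 - q \<le> 1 - p n"
  using p_range[of n] p_le_q[of n] by auto

section \<open>Clock time spent at a fixed count\<close>

lemma AE_summable_hist:
  fixes f :: "nat list \<Rightarrow> real"
  assumes nn: "\<And>h. 0 \<le> f h"
    and bd: "\<And>N. (\<Sum>n<N. \<integral>\<omega>. f (hist (Suc n) \<omega>) \<partial>M) \<le> C"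
  shows "AE \<omega> in M. summable (\<lambda>n. f (hist (Suc n) \<omega>))"
proof -
  have [measurable]: "(\<lambda>\<omega>. f (hist n \<omega>)) \<in> borel_measurable M" for n
    by (rule measurable_compose[OF hist_meas]) simp
  have nn': "0 \<le> (\<integral>\<omega>. f (hist n \<omega>) \<partial>M)" for n using nn by simp
  have "(\<integral>\<^sup>+\<omega>. (\<Sum>n. ennreal (f (hist (Suc n) \<omega>))) \<partial>M) = (\<Sum>n. \<integral>\<^sup>+\<omega>. ennreal (f (hist (Suc n) \<omega>)) \<partial>M)"
    by (rule nn_integral_suminf) simp
  also have "\<dots> = (\<Sum>n. ennreal (\<integral>\<omega>. f (hist (Suc n) \<omega>) \<partial>M))"
    using nn by (intro suminf_cong nn_integral_eq_integral integral_hist) auto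
  also have "\<dots> \<le> ennreal C"
    by (rule suminf_le_const) (use nn' bd in \<open>auto simp: sum_ennreal intro!: ennreal_leI\<close>)
  finally have "(\<integral>\<^sup>+\<omega>. (\<Sum>n. ennreal (f (hist (Suc n) \<omega>))) \<partial>M) \<noteq> \<infinity>"
    by (auto simp: top_unique)
  then have "AE \<omega> in M. (\<Sum>n. ennreal (f (hist (Suc n) \<omega>))) \<noteq> \<infinity>"
    by (intro nn_integral_PInf_AE) simp_all
  then show ?thesis
    by eventually_elim (use nn in \<open>auto intro: summable_suminf_not_top\<close>)
qed

text \<open>The probability that the count exceeds k is at most 1, and a step started at count k
  raises its conditional value by at least \<open>(1 - q) * wt k / W h\<close>. Summing these gains
  bounds the expected clock time at level k.\<close>

lemma sojourn:
  assumes k: "1 \<le> k"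
  shows "(\<Sum>n<N. \<integral>\<omega>. of_bool (hist_count (hist (Suc n) \<omega>) c = k) / W (hist (Suc n) \<omega>) \<partial>M)
    \<le> 1 / ((1 - q) * wt k)"
proof -
  define f where "f = (\<lambda>h. of_bool (k < hist_count h c) :: real)"
  define g where "g = (\<lambda>h. of_bool (hist_count h c = k) / W h)"
  have kpos: "0 < wt k" using wt_pos[OF k] .
  have "(1 - q) * wt k * (\<Sum>n<N. \<integral>\<omega>. g (hist (Suc n) \<omega>) \<partial>M) \<le> (\<integral>\<omega>. f (hist (Suc N) \<omega>) \<partial>M)"
  proof (induction N)
    case 0
    show ?case by (simp add: f_def)
  next
    case (Suc N)
    have "(\<integral>\<omega>. f (hist (Suc N) \<omega>) + (1 - q) * wt k * g (hist (Suc N) \<omega>) \<partial>M)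
        \<le> (\<integral>\<omega>. step f (hist (Suc N) \<omega>) \<partial>M)"
    proof (rule integral_hist_mono)
      fix h assume h: "h \<in> hists (Suc N)"
      have "h \<noteq> []" using h by auto
      then have Wp: "0 < W h" by (rule W_pos)
      have "step f h = f h + (1 - p (Suc N)) * (if c \<in> set h then wt (hist_count h c) / W h *
        (of_bool (k < Suc (hist_count h c)) - f h) else 0)"
        unfolding f_def using k by (intro step_count[OF h, where \<phi>="\<lambda>i. of_bool (k < i)"]) auto
      moreover have "(1 - q) * wt k * g h \<le> (1 - p (Suc N)) * (if c \<in> set h then wt (hist_count h c) / W h *
        (of_bool (k < Suc (hist_count h c)) - f h) else 0)"
      proof (cases "hist_count h c = k")
        case True
        then have "c \<in> set h" using k hist_count_pos_iff[of h c] by simp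
        then show ?thesis using True p_bounds(3)[of "Suc N"] kpos Wp
          by (auto simp: f_def g_def intro!: divide_right_mono mult_right_mono)
      next
        case False
        then show ?thesis by (auto simp: g_def f_def)
      qed
      ultimately show "f h + (1 - q) * wt k * g h \<le> step f h" by simp
    qed
    moreover have "(\<integral>\<omega>. f (hist (Suc (Suc N)) \<omega>) \<partial>M) = (\<integral>\<omega>. step f (hist (Suc N) \<omega>) \<partial>M)"
      by (rule integral_hist_Suc) simp
    moreover have "(\<integral>\<omega>. f (hist (Suc N) \<omega>) + (1 - q) * wt k * g (hist (Suc N) \<omega>) \<partial>M)
       = (\<integral>\<omega>. f (hist (Suc N) \<omega>) \<partial>M) + (1 - q) * wt k * (\<integral>\<omega>. g (hist (Suc N) \<omega>) \<partial>M)"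
      by (subst Bochner_Integration.integral_add)
        (auto intro: integral_hist(1) integrable_mult_right)
    ultimately show ?case using Suc by (simp add: algebra_simps)
  qed
  also have "(\<integral>\<omega>. f (hist (Suc N) \<omega>) \<partial>M) \<le> (\<integral>\<omega>. 1 \<partial>M)"
    by (rule integral_hist_mono[where g="\<lambda>_. 1"]) (auto simp: f_def)
  finally have "(1 - q) * wt k * (\<Sum>n<N. \<integral>\<omega>. g (hist (Suc n) \<omega>) \<partial>M) \<le> 1"
    by (simp add: prob_space)
  moreover have "0 < (1 - q) * wt k" using kpos q_lt1 by simp
  ultimately show ?thesis unfolding g_def by (simp add: pos_le_divide_eq mult.commute)
qed

lemma AE_stuck:
  "AE \<omega> in M. \<forall>c k. 1 \<le> k \<longrightarrow>
     summable (\<lambda>n. of_bool (hist_count (hist (Suc n) \<omega>) c = k) / W (hist (Suc n) \<omega>))"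
proof (unfold AE_all_countable, intro allI)
  fix c k :: nat
  show "AE \<omega> in M. 1 \<le> k \<longrightarrow>
     summable (\<lambda>n. of_bool (hist_count (hist (Suc n) \<omega>) c = k) / W (hist (Suc n) \<omega>))"
  proof (cases "1 \<le> k")
    case True
    have "AE \<omega> in M. summable (\<lambda>n. of_bool (hist_count (hist (Suc n) \<omega>) c = k) / W (hist (Suc n) \<omega>))"
      by (rule AE_summable_hist[where f="\<lambda>h. of_bool (hist_count h c = k) / W h", OF _ sojourn[OF True]])
        (simp add: W_nonneg)
    then show ?thesis by simp
  qed simp
qed

lemma one_in_hists: "h \<in> hists n \<Longrightarrow> 1 \<le> n \<Longrightarrow> 1 \<in> set h"
  using set_hists[of h n] length_hists[of h n]
  by (metis List.finite_set atLeastAtMost_iff card_0_eq le_refl length_0_conv less_one not_le set_empty)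

text \<open>Colour 1 is present from time 1 on and always sits at exactly one level, so the whole
  clock is the sum of its sojourn times, whose expectations are summable.\<close>

lemma AE_summable_inverse_W:
  assumes "summable (\<lambda>k. 1 / wt (Suc k))"
  shows "AE \<omega> in M. summable (\<lambda>n. 1 / W (hist (Suc n) \<omega>))"
proof (rule AE_summable_hist[where f="\<lambda>h. 1 / W h"])
  fix N :: nat
  let ?g = "\<lambda>k h. of_bool (hist_count h 1 = Suc k) / W h"
  have nn: "0 \<le> (\<integral>\<omega>. ?g k (hist n \<omega>) \<partial>M)" for k n
    by (simp add: W_nonneg)
  have "(\<Sum>n<N. \<integral>\<omega>. 1 / W (hist (Suc n) \<omega>) \<partial>M) = (\<Sum>n<N. \<Sum>k\<le>N. \<integral>\<omega>. ?g k (hist (Suc n) \<omega>) \<partial>M)"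
  proof (intro sum.cong refl)
    fix n assume n: "n \<in> {..<N}"
    have "(\<integral>\<omega>. 1 / W (hist (Suc n) \<omega>) \<partial>M) = (\<integral>\<omega>. (\<Sum>k\<le>N. ?g k (hist (Suc n) \<omega>)) \<partial>M)"
    proof (rule integral_hist_cong[where f="\<lambda>h. 1 / W h" and g="\<lambda>h. \<Sum>k\<le>N. ?g k h"])
      fix h assume h: "h \<in> hists (Suc n)"
      have "0 < hist_count h 1" using one_in_hists[OF h] hist_count_pos_iff by simp
      then obtain j where j: "hist_count h 1 = Suc j" using gr0_conv_Suc by blast
      have "Suc j \<le> Suc n" using hist_count_le_length[of h 1] j length_hists[OF h] by simp
      then have "j \<in> {..N}" using n by simp
      then show "1 / W h = (\<Sum>k\<le>N. ?g k h)"
        unfolding j sum_divide_distrib[symmetric] by (simp add: of_bool_def)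
    qed
    also have "\<dots> = (\<Sum>k\<le>N. \<integral>\<omega>. ?g k (hist (Suc n) \<omega>) \<partial>M)"
      by (rule Bochner_Integration.integral_sum) (rule integral_hist(1))
    finally show "(\<integral>\<omega>. 1 / W (hist (Suc n) \<omega>) \<partial>M) = (\<Sum>k\<le>N. \<integral>\<omega>. ?g k (hist (Suc n) \<omega>) \<partial>M)" .
  qed
  also have "\<dots> = (\<Sum>k\<le>N. \<Sum>n<N. \<integral>\<omega>. ?g k (hist (Suc n) \<omega>) \<partial>M)"
    by (rule sum.swap)
  also have "\<dots> \<le> (\<Sum>k\<le>N. 1 / ((1 - q) * wt (Suc k)))"
    by (intro sum_mono sojourn) simp
  also have "\<dots> = (\<Sum>k\<le>N. 1 / wt (Suc k)) / (1 - q)"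
    by (simp add: sum_divide_distrib mult.commute)
  also have "\<dots> \<le> (\<Sum>k. 1 / wt (Suc k)) / (1 - q)"
    using q_lt1 wt_pos by (intro divide_right_mono sum_le_suminf[OF assms]) (auto simp: less_imp_le)
  finally show "(\<Sum>n<N. \<integral>\<omega>. 1 / W (hist (Suc n) \<omega>) \<partial>M) \<le> (\<Sum>k. 1 / wt (Suc k)) / (1 - q)" .
qed (simp add: W_nonneg)

section \<open>The clock and exponential bounds for one count\<close>

definition clock :: "nat list \<Rightarrow> real" where
  "clock h = (\<Sum>l\<in>{1..<length h}. 1 / W (take l h))"

lemma clock_hist: "clock (hist n \<omega>) = (\<Sum>l\<in>{1..<n}. 1 / W (hist l \<omega>))"
  unfolding clock_def by (simp add: take_hist)

text \<open>Discrete counterpart of \<open>exp (- \<kappa> * clock h)\<close>. The product form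
  cancels the drift of \<open>growth\<close> factor by factor.\<close>

definition disc :: "real \<Rightarrow> nat list \<Rightarrow> real" where
  "disc \<kappa> h = (\<Prod>l\<in>{1..<length h}. inverse (1 + \<kappa> / W (take l h)))"

text \<open>In Rubin's embedding a colour reaches count k after independent exponential times of
  rates \<open>wt i\<close> with i < k. The product is the reciprocal of the Laplace transform of
  their sum at \<kappa>.\<close>

definition growth :: "real \<Rightarrow> nat \<Rightarrow> real" where
  "growth \<kappa> k = (\<Prod>i\<in>{1..<k}. 1 + \<kappa> / wt i)"

lemma growth_pos: "0 \<le> \<kappa> \<Longrightarrow> 0 < growth \<kappa> k"
  unfolding growth_def by (intro prod_pos) (auto intro!: add_pos_nonneg divide_nonneg_pos wt_pos)

lemma growth_mono: "0 \<le> \<kappa> \<Longrightarrow> i \<le> j \<Longrightarrow> growth \<kappa> i \<le> growth \<kappa> j"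
  unfolding growth_def using wt_pos
  by (intro prod_mono2) (auto intro!: divide_nonneg_pos add_nonneg_nonneg)

lemma growth_Suc: "1 \<le> k \<Longrightarrow> growth \<kappa> (Suc k) = growth \<kappa> k * (1 + \<kappa> / wt k)"
  unfolding growth_def by (simp add: atLeastLessThanSuc)

lemma growth_01 [simp]: "growth \<kappa> 0 = 1" "growth \<kappa> 1 = 1" "growth \<kappa> (Suc 0) = 1"
  by (simp_all add: growth_def)

lemma disc_snoc: "1 \<le> length h \<Longrightarrow> disc \<kappa> (h @ [c]) = disc \<kappa> h * inverse (1 + \<kappa> / W h)"
  unfolding disc_def by (simp add: atLeastLessThanSuc)

lemma disc_ge:
  assumes "0 \<le> \<kappa>"
  shows "exp (- \<kappa> * clock h) \<le> disc \<kappa> h"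
proof -
  have "exp (- \<kappa> * clock h) = (\<Prod>l\<in>{1..<length h}. exp (- (\<kappa> / W (take l h))))"
    unfolding clock_def by (simp add: sum_distrib_left exp_sum[symmetric] sum_negf)
  also have "\<dots> \<le> disc \<kappa> h"
    unfolding disc_def
  proof (intro prod_mono conjI)
    fix l assume "l \<in> {1..<length h}"
    show "exp (- (\<kappa> / W (take l h))) \<le> inverse (1 + \<kappa> / W (take l h))"
      unfolding exp_minus using assms W_nonneg
      by (intro le_imp_inverse_le exp_ge_add_one_self) (auto intro!: add_pos_nonneg)
  qed simp
  finally show ?thesis .
qed

text \<open>A draw of c at count k multiplies \<open>growth\<close> by
  \<open>1 + \<kappa> / wt k\<close> and has probability at most \<open>wt k / W h\<close>. The
  weight \<open>wt k\<close> cancels, leaving an expected factor of at most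
  \<open>1 + \<kappa> / W h\<close>, which \<open>disc\<close> undoes.\<close>

lemma expectation_disc_growth:
  assumes l: "0 \<le> \<kappa>"
  shows "(\<integral>\<omega>. disc \<kappa> (hist (Suc n) \<omega>) * growth \<kappa> (hist_count (hist (Suc n) \<omega>) c) \<partial>M) \<le> 1"
proof (induction n)
  case 0
  have "(\<integral>\<omega>. disc \<kappa> (hist (Suc 0) \<omega>) * growth \<kappa> (hist_count (hist (Suc 0) \<omega>) c) \<partial>M) \<le> (\<integral>\<omega>. 1 \<partial>M)"
    by (rule integral_hist_mono[where f="\<lambda>h. disc \<kappa> h * growth \<kappa> (hist_count h c)" and g="\<lambda>_. 1"])
      (auto simp: disc_def hist_count_snoc[of "[]", simplified])
  then show ?case by (simp add: prob_space)
next
  case (Suc n)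
  let ?f = "\<lambda>h. disc \<kappa> h * growth \<kappa> (hist_count h c)"
  have "(\<integral>\<omega>. ?f (hist (Suc (Suc n)) \<omega>) \<partial>M) = (\<integral>\<omega>. step ?f (hist (Suc n) \<omega>) \<partial>M)"
    by (rule integral_hist_Suc) simp
  also have "\<dots> \<le> (\<integral>\<omega>. ?f (hist (Suc n) \<omega>) \<partial>M)"
  proof (rule integral_hist_mono)
    fix h assume h: "h \<in> hists (Suc n)"
    have len: "length h = Suc n" using length_hists[OF h] .
    have Wp: "0 < W h" using len by (intro W_pos) auto
    let ?g = "\<lambda>h. growth \<kappa> (hist_count h c)"
    have d0: "0 \<le> disc \<kappa> h" using disc_ge[OF l, of h] by (meson exp_ge_zero order_trans)
    have "step ?f h = disc \<kappa> h * inverse (1 + \<kappa> / W h) * step ?g h"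
      unfolding step_def using len
      by (simp add: disc_snoc sum_distrib_left sum_distrib_right algebra_simps)
    also have "step ?g h \<le> ?g h * (1 + \<kappa> / W h)"
    proof -
      have "step ?g h = ?g h + (1 - p (Suc n)) * (if c \<in> set h then wt (hist_count h c) / W h * (growth \<kappa> (Suc (hist_count h c)) - ?g h) else 0)"
        by (rule step_count[OF h]) auto
      also have "(if c \<in> set h then wt (hist_count h c) / W h * (growth \<kappa> (Suc (hist_count h c)) - ?g h) else 0)
          \<le> ?g h * (\<kappa> / W h)"
      proof (cases "c \<in> set h")
        case True
        then have "1 \<le> hist_count h c" using hist_count_pos_iff[of h c] by simp
        then show ?thesis using True wt_count_pos[OF True] by (simp add: growth_Suc field_simps)
      next
        case False
        then show ?thesis using l Wp growth_pos[OF l] by (simp add: less_imp_le)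
      qed
      also have "(1 - p (Suc n)) * (?g h * (\<kappa> / W h)) \<le> 1 * (?g h * (\<kappa> / W h))"
        using p_bounds[of "Suc n"] l Wp growth_pos[OF l] by (intro mult_right_mono) (auto simp: less_imp_le)
      also have "?g h + 1 * (?g h * (\<kappa> / W h)) = ?g h * (1 + \<kappa> / W h)"
        by (simp add: algebra_simps)
      finally show ?thesis using p_bounds(2)[of "Suc n"] by simp
    qed
    finally have "step ?f h \<le> disc \<kappa> h * inverse (1 + \<kappa> / W h) * (?g h * (1 + \<kappa> / W h))"
      using d0 l Wp by (simp add: mult_left_mono)
    also have "\<dots> = ?f h"
    proof -
      have "1 + \<kappa> / W h \<noteq> 0" using l Wp by (smt (verit) divide_nonneg_pos)
      then show ?thesis by simp
    qed
    finally show "step ?f h \<le> ?f h" .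
  qed
  finally show ?case using Suc by simp
qed

lemma prob_hist: "prob {\<omega>\<in>space M. P (hist n \<omega>)} = (\<integral>\<omega>. of_bool (P (hist n \<omega>)) \<partial>M)"
proof -
  have "(\<integral>\<omega>. of_bool (P (hist n \<omega>)) \<partial>M) = (\<integral>\<omega>. indicator {\<omega>\<in>space M. P (hist n \<omega>)} \<omega> \<partial>M)"
    by (intro Bochner_Integration.integral_cong) (auto simp: indicator_def)
  also have "\<dots> = prob {\<omega>\<in>space M. P (hist n \<omega>)}"
    by (simp add: Int_absorb1 Collect_conj_eq flip: Collect_conj_eq)
  finally show ?thesis by simp
qed

text \<open>Markov's inequality: on the event, the discounted supermartingale is at least
  \<open>exp (- \<kappa> * s) * growth \<kappa> k\<close>.\<close>

lemma count_tail:
  assumes l: "0 \<le> \<kappa>"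
  shows "prob {\<omega>\<in>space M. clock (hist (Suc n) \<omega>) \<le> s \<and> k \<le> hist_count (hist (Suc n) \<omega>) c}
    \<le> exp (\<kappa> * s) / growth \<kappa> k"
proof -
  let ?C = "exp (\<kappa> * s) / growth \<kappa> k"
  have C: "0 < ?C" using growth_pos[OF l] by simp
  have "prob {\<omega>\<in>space M. clock (hist (Suc n) \<omega>) \<le> s \<and> k \<le> hist_count (hist (Suc n) \<omega>) c}
    = (\<integral>\<omega>. of_bool (clock (hist (Suc n) \<omega>) \<le> s \<and> k \<le> hist_count (hist (Suc n) \<omega>) c) \<partial>M)"
    by (rule prob_hist)
  also have "\<dots> \<le> (\<integral>\<omega>. ?C * (disc \<kappa> (hist (Suc n) \<omega>) * growth \<kappa> (hist_count (hist (Suc n) \<omega>) c)) \<partial>M)"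
  proof (rule integral_hist_mono[where f="\<lambda>h. of_bool (clock h \<le> s \<and> k \<le> hist_count h c)"
        and g="\<lambda>h. ?C * (disc \<kappa> h * growth \<kappa> (hist_count h c))"])
    fix h
    have d: "exp (- \<kappa> * clock h) \<le> disc \<kappa> h" by (rule disc_ge[OF l])
    have nn: "0 \<le> disc \<kappa> h * growth \<kappa> (hist_count h c)"
      using d growth_pos[OF l] by (meson exp_ge_zero order_trans mult_nonneg_nonneg less_imp_le)
    show "of_bool (clock h \<le> s \<and> k \<le> hist_count h c) \<le> ?C * (disc \<kappa> h * growth \<kappa> (hist_count h c))"
    proof (cases "clock h \<le> s \<and> k \<le> hist_count h c")
      case True
      have "exp (- (\<kappa> * s)) \<le> exp (- \<kappa> * clock h)" using True l by (simp add: mult_left_mono)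
      then have "exp (- (\<kappa> * s)) \<le> disc \<kappa> h" using d by (rule order_trans)
      then have "exp (- (\<kappa> * s)) * growth \<kappa> k \<le> disc \<kappa> h * growth \<kappa> (hist_count h c)"
        using d True growth_pos[OF l] order_trans[OF exp_ge_zero d]
        by (intro mult_mono growth_mono[OF l]) (auto simp: less_imp_le)
      then have "?C * (exp (- (\<kappa> * s)) * growth \<kappa> k) \<le> ?C * (disc \<kappa> h * growth \<kappa> (hist_count h c))"
        using C by (intro mult_left_mono) auto
      moreover have "?C * (exp (- (\<kappa> * s)) * growth \<kappa> k) = 1"
        using growth_pos[OF l, of k] by (simp add: exp_minus field_simps)
      ultimately show ?thesis using True by simp
    next
      case False
      then have "of_bool (clock h \<le> s \<and> k \<le> hist_count h c) = (0::real)" by simp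
      then show ?thesis using mult_nonneg_nonneg[OF less_imp_le[OF C] nn] by (simp only:)
    qed
  qed
  also have "\<dots> = ?C * (\<integral>\<omega>. disc \<kappa> (hist (Suc n) \<omega>) * growth \<kappa> (hist_count (hist (Suc n) \<omega>) c) \<partial>M)"
    by simp
  also have "\<dots> \<le> ?C * 1"
    using C by (intro mult_left_mono expectation_disc_growth[OF l]) auto
  finally show ?thesis by simp
qed

text \<open>With the clock bound imposed at all times, the events increase in n because the counts
  do, so the uniform bound of \<open>count_tail\<close> survives in the limit.\<close>

lemma prob_unbounded_count:
  assumes l: "0 \<le> \<kappa>"
  shows "prob {\<omega>\<in>space M. (\<forall>n. clock (hist n \<omega>) \<le> s) \<and> (\<exists>n. k \<le> hist_count (hist n \<omega>) c)}
    \<le> exp (\<kappa> * s) / growth \<kappa> k"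
proof -
  define A where "A n = {\<omega>\<in>space M. (\<forall>n. clock (hist n \<omega>) \<le> s) \<and> k \<le> hist_count (hist (Suc n) \<omega>) c}" for n
  have [measurable]: "A n \<in> sets M" for n
    unfolding A_def by measurable
  have "A n \<subseteq> A m" if "n \<le> m" for n m
  proof
    fix \<omega> assume a: "\<omega> \<in> A n"
    have "hist_count (hist (Suc n) \<omega>) c \<le> hist_count (hist (Suc m) \<omega>) c"
      using that by (intro hist_count_hist_mono) simp
    then show "\<omega> \<in> A m" using a unfolding A_def by simp
  qed
  then have "incseq A" by (simp add: incseq_def)
  then have "(\<lambda>n. prob (A n)) \<longlonglongrightarrow> prob (\<Union>n. A n)"
    by (intro finite_Lim_measure_incseq) auto
  moreover have "prob (A n) \<le> exp (\<kappa> * s) / growth \<kappa> k" for n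
    by (rule order_trans[OF finite_measure_mono count_tail[OF l]]) (auto simp: A_def)
  ultimately have "prob (\<Union>n. A n) \<le> exp (\<kappa> * s) / growth \<kappa> k"
    by (intro LIMSEQ_le_const2) auto
  moreover have "{\<omega>\<in>space M. (\<forall>n. clock (hist n \<omega>) \<le> s) \<and> (\<exists>n. k \<le> hist_count (hist n \<omega>) c)} = (\<Union>n. A n)"
  proof (intro equalityI subsetI)
    fix \<omega> assume a: "\<omega> \<in> {\<omega>\<in>space M. (\<forall>n. clock (hist n \<omega>) \<le> s) \<and> (\<exists>n. k \<le> hist_count (hist n \<omega>) c)}"
    then obtain n where "k \<le> hist_count (hist n \<omega>) c" by blast
    also have "\<dots> \<le> hist_count (hist (Suc n) \<omega>) c" by (rule hist_count_hist_mono) simp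
    finally show "\<omega> \<in> (\<Union>n. A n)" using a unfolding A_def by blast
  qed (auto simp: A_def)
  ultimately show ?thesis by simp
qed

lemma growth_1_at_top:
  assumes "\<not> summable (\<lambda>k. 1 / wt (Suc k))"
  shows "\<exists>k. C \<le> growth 1 k"
proof (rule ccontr)
  assume "\<not> ?thesis"
  then have C: "growth 1 k \<le> C" for k by (auto simp: not_le intro: less_imp_le)
  have "summable (\<lambda>k. 1 / wt (Suc k))"
  proof (rule bounded_imp_summable)
    fix n
    have "(\<Sum>k\<le>n. 1 / wt (Suc k)) = (\<Sum>i\<in>{1..<Suc (Suc n)}. 1 / wt i)"
      by (rule sum.reindex_bij_witness[of _ "\<lambda>i. i - 1" Suc]) auto
    also have "\<dots> \<le> growth 1 (Suc (Suc n))"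
      unfolding growth_def using wt_pos
      by (intro sum_le_prod) (auto intro: less_imp_le)
    also have "\<dots> \<le> C" by (rule C)
    finally show "(\<Sum>k\<le>n. 1 / wt (Suc k)) \<le> C" .
  qed (use wt_pos in \<open>auto intro: less_imp_le\<close>)
  then show False using assms by simp
qed

lemma clock_bounded:
  assumes "summable (\<lambda>n. 1 / W (hist (Suc n) \<omega>))"
  shows "\<exists>s::nat. \<forall>n. clock (hist n \<omega>) \<le> real s"
proof -
  obtain s :: nat where s: "(\<Sum>n. 1 / W (hist (Suc n) \<omega>)) \<le> real s" using real_arch_simple by blast
  have "clock (hist n \<omega>) \<le> real s" for n
  proof -
    have "clock (hist n \<omega>) = (\<Sum>k<n-1. 1 / W (hist (Suc k) \<omega>))"
      unfolding clock_hist by (rule sum.reindex_bij_witness[of _ Suc "\<lambda>i. i - 1"]) auto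
    also have "\<dots> \<le> (\<Sum>n. 1 / W (hist (Suc n) \<omega>))"
      by (intro sum_le_suminf[OF assms]) (auto simp: W_nonneg)
    finally show ?thesis using s by simp
  qed
  then show ?thesis by blast
qed

text \<open>At rate 1 the bound \<open>exp s / growth 1 k\<close> becomes arbitrarily small, since
  \<open>growth 1\<close> dominates the partial sums of the divergent series.\<close>

lemma AE_counts_bounded:
  assumes ns: "\<not> summable (\<lambda>k. 1 / wt (Suc k))"
  shows "AE \<omega> in M. summable (\<lambda>n. 1 / W (hist (Suc n) \<omega>)) \<longrightarrow> (\<forall>c. \<exists>k. \<forall>n. hist_count (hist n \<omega>) c < k)"
proof -
  have "AE \<omega> in M. \<forall>s::nat. \<forall>c. (\<forall>n. clock (hist n \<omega>) \<le> real s) \<longrightarrow> (\<exists>k. \<forall>n. hist_count (hist n \<omega>) c < k)"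
  proof (unfold AE_all_countable, intro allI)
    fix s c :: nat
    let ?A = "{\<omega>\<in>space M. (\<forall>n. clock (hist n \<omega>) \<le> real s) \<and> (\<forall>k. \<exists>n. k \<le> hist_count (hist n \<omega>) c)}"
    have A: "?A \<in> sets M" by measurable
    have le: "prob ?A \<le> exp s / growth 1 k" for k
    proof -
      have "prob ?A \<le> prob {\<omega>\<in>space M. (\<forall>n. clock (hist n \<omega>) \<le> real s) \<and> (\<exists>n. k \<le> hist_count (hist n \<omega>) c)}"
        by (intro finite_measure_mono) auto
      also have "\<dots> \<le> exp (1 * real s) / growth 1 k" by (rule prob_unbounded_count) simp
      finally show ?thesis by simp
    qed
    have "prob ?A \<le> e" if "0 < e" for e
    proof -
      obtain k where "exp s / e \<le> growth 1 k" using growth_1_at_top[OF ns] by blast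
      then have "exp s / growth 1 k \<le> e" using that growth_pos[of 1 k] by (simp add: field_simps)
      then show ?thesis using le[of k] by simp
    qed
    then have "prob ?A = 0" by (meson dense_ge measure_nonneg antisym)
    then have "?A \<in> null_sets M" using A by (simp add: emeasure_eq_measure null_sets_def)
    from AE_not_in[OF this] AE_space
    show "AE \<omega> in M. (\<forall>n. clock (hist n \<omega>) \<le> real s) \<longrightarrow> (\<exists>k. \<forall>n. hist_count (hist n \<omega>) c < k)"
    proof eventually_elim
      case (elim \<omega>)
      then have "\<not> (\<forall>n. clock (hist n \<omega>) \<le> real s) \<or> (\<exists>k. \<forall>n. \<not> k \<le> hist_count (hist n \<omega>) c)"
        by blast
      then show ?case unfolding not_le by blast
    qed
  qed
  then show ?thesis by eventually_elim (use clock_bounded in blast)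
qed

section \<open>Divergence of the clock for sublinear weights\<close>

lemma weight_le_if_counts_less:
  assumes j: "\<And>c. c \<in> set h \<Longrightarrow> hist_count h c \<le> j" and h: "h \<in> hists n"
  shows "W h \<le> real n * wt j"
proof -
  have "W h \<le> (\<Sum>c\<in>set h. wt j)"
    unfolding W_def using j hist_count_pos_iff by (intro sum_mono wt_mono) (auto simp: Suc_le_eq)
  also have "\<dots> \<le> real n * wt j"
  proof (cases "h = []")
    case True
    then show ?thesis using length_hists[OF h] by simp
  next
    case False
    then obtain c where "c \<in> set h" by (metis last_in_set)
    then have "1 \<le> j" using j[of c] hist_count_pos_iff[of h c] by simp
    then show ?thesis
      using wt_pos[of j] card_set_hists_le[OF h] by (simp add: mult_right_mono)
  qed
  finally show ?thesis .
qed

lemma growth_ge_pow: "growth (wt j) j \<ge> 2 ^ (j - 1)" if "1 \<le> j"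
proof -
  have "2 ^ (j - 1) = (\<Prod>i\<in>{1..<j}. 2::real)" by simp
  also have "\<dots> \<le> growth (wt j) j"
    unfolding growth_def
  proof (intro prod_mono conjI)
    fix i assume i: "i \<in> {1..<j}"
    then have "wt i \<le> wt j" "0 < wt i" using wt_mono[of i j] wt_pos[of i] by auto
    then show "2 \<le> 1 + wt j / wt i" by (simp add: field_simps)
  qed simp
  finally show ?thesis .
qed

text \<open>If no colour reaches count j by time N, then \<open>W\<close> at time l is at most
  \<open>l * wt j\<close>, and comparison with a harmonic sum pushes the clock beyond s. So one of
  at most N colours reaches j while the clock is still below s, and \<open>count_tail\<close> at
  rate \<open>wt j\<close> controls each of them.\<close>

lemma prob_clock_bounded:
  assumes j: "1 \<le> j" and s: "0 \<le> s"
  shows "prob {\<omega>\<in>space M. \<forall>n. clock (hist n \<omega>) \<le> s} \<le> 3 * exp (2 * s * wt j) / 2 ^ (j - 1)"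
proof -
  have wj: "0 < wt j" using wt_pos[OF j] .
  \<comment> \<open>N lies just above \<open>exp (s * wt j)\<close>, so that \<open>ln N\<close>
    exceeds \<open>s * wt j\<close>. The factor 3 below absorbs the rounding, the exponential being
    at least 1.\<close>
  define N where "N = nat \<lceil>exp (s * wt j)\<rceil> + 1"
  have N: "exp (s * wt j) < real N" "real N \<le> 3 * exp (s * wt j)"
  proof -
    have "1 \<le> exp (s * wt j)" using s wj by simp
    then show "exp (s * wt j) < real N" "real N \<le> 3 * exp (s * wt j)"
      unfolding N_def by linarith+
  qed
  have N0: "N = Suc (N - 1)" unfolding N_def by simp
  let ?E = "\<lambda>c. {\<omega>\<in>space M. clock (hist N \<omega>) \<le> s \<and> j \<le> hist_count (hist N \<omega>) c}"
  have "prob {\<omega>\<in>space M. \<forall>n. clock (hist n \<omega>) \<le> s} \<le> prob (\<Union>c\<in>{1..N}. ?E c)"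
  proof (rule finite_measure_mono_AE)
    show "AE \<omega> in M. \<omega> \<in> {\<omega>\<in>space M. \<forall>n. clock (hist n \<omega>) \<le> s} \<longrightarrow> \<omega> \<in> (\<Union>c\<in>{1..N}. ?E c)"
      using AE_hist_in AE_space
    proof (eventually_elim)
      fix \<omega> assume e1: "\<forall>n. hist n \<omega> \<in> hists n" "\<omega> \<in> space M"
      show "\<omega> \<in> {\<omega>\<in>space M. \<forall>n. clock (hist n \<omega>) \<le> s} \<longrightarrow> \<omega> \<in> (\<Union>c\<in>{1..N}. ?E c)"
      proof
        assume e2: "\<omega> \<in> {\<omega>\<in>space M. \<forall>n. clock (hist n \<omega>) \<le> s}"
        note elim = e1 e2
        have "\<exists>c\<in>{1..N}. j \<le> hist_count (hist N \<omega>) c"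
        proof (rule ccontr)
          assume neg: "\<not> ?thesis"
          have small: "hist_count (hist l \<omega>) c \<le> j" if "l \<le> N" "c \<in> set (hist l \<omega>)" for l c
          proof -
            have hl: "hist l \<omega> \<in> hists l" using elim(1) by blast
            have "c \<in> {1..card (set (hist l \<omega>))}" using that(2) set_hists[OF hl] by simp
            then have "c \<in> {1..N}" using card_set_hists_le[OF hl] that(1) by simp
            then have "hist_count (hist N \<omega>) c < j" using neg by (simp add: not_le)
            then show ?thesis using hist_count_hist_mono[OF that(1), of \<omega> c] by simp
          qed
          have "s * wt j < ln (real N)"
            using N by (metis exp_gt_zero less_trans ln_exp ln_less_cancel_iff)
          also have "\<dots> \<le> harm (N - 1)" using ln_le_harm[of "N - 1"] by (subst N0) (simp add: add.commute)
          also have "\<dots> = (\<Sum>l\<in>{1..<N}. 1 / real l)"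
            unfolding harm_def by (rule sum.cong) (auto simp: inverse_eq_divide N_def)
          finally have "s < (\<Sum>l\<in>{1..<N}. 1 / real l) / wt j" using wj by (simp add: field_simps)
          also have "\<dots> = (\<Sum>l\<in>{1..<N}. 1 / (real l * wt j))" by (simp add: sum_divide_distrib)
          also have "\<dots> \<le> clock (hist N \<omega>)"
            unfolding clock_hist
          proof (intro sum_mono)
            fix l assume l: "l \<in> {1..<N}"
            have "W (hist l \<omega>) \<le> real l * wt j"
              using elim(1) small l by (intro weight_le_if_counts_less) auto
            moreover have "0 < W (hist l \<omega>)" using l by (intro W_pos) (auto simp: hist_def)
            ultimately show "1 / (real l * wt j) \<le> 1 / W (hist l \<omega>)"
              by (intro divide_left_mono) (auto intro: mult_pos_pos)
          qed
          finally have "s < clock (hist N \<omega>)" .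
          moreover have "clock (hist N \<omega>) \<le> s" using elim by blast
          ultimately show False by simp
        qed
        then show "\<omega> \<in> (\<Union>c\<in>{1..N}. ?E c)" using elim by auto
      qed
    qed
    show "(\<Union>c\<in>{1..N}. ?E c) \<in> sets M" by measurable
  qed
  also have "\<dots> \<le> (\<Sum>c\<in>{1..N}. prob (?E c))"
    by (intro finite_measure_subadditive_finite) auto
  also have "\<dots> \<le> (\<Sum>c\<in>{1..N}. exp (wt j * s) / growth (wt j) j)"
    by (subst (1 2) N0) (intro sum_mono count_tail, use wj in simp)
  also have "\<dots> = real N * (exp (wt j * s) / growth (wt j) j)" by simp
  also have "\<dots> \<le> (3 * exp (s * wt j)) * (exp (wt j * s) / 2 ^ (j - 1))"
    using N(2) growth_ge_pow[OF j] growth_pos[of "wt j" j] wj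
    by (intro mult_mono divide_left_mono) (auto intro!: mult_pos_pos)
  also have "\<dots> = 3 * exp (2 * s * wt j) / 2 ^ (j - 1)"
    by (simp add: mult_exp_exp algebra_simps)
  finally show ?thesis .
qed

lemma AE_not_summable_sublinear:
  assumes sub: "\<And>a. 0 < a \<Longrightarrow> \<exists>j\<ge>1. wt j < a * real j"
  shows "AE \<omega> in M. \<not> summable (\<lambda>n. 1 / W (hist (Suc n) \<omega>))"
proof -
  have "AE \<omega> in M. \<forall>s::nat. \<not> (\<forall>n. clock (hist n \<omega>) \<le> real s)"
  proof (unfold AE_all_countable, intro allI)
    fix s :: nat
    let ?A = "{\<omega>\<in>space M. \<forall>n. clock (hist n \<omega>) \<le> real s}"
    \<comment> \<open>This slope gives \<open>2 * s * wt j \<le> ln 2 / 2 * j\<close>, so the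
      exponential in \<open>prob_clock_bounded\<close> uses up only the square root of
      \<open>2 ^ j\<close>.\<close>
    define a where "a = ln 2 / (4 * (real s + 1))"
    have a0: "0 < a" unfolding a_def by simp
    have lin: "(\<lambda>j::nat. 6 * exp (- (ln 2 / 2) * real j)) \<longlonglongrightarrow> 0"
      by real_asymp
    have "prob ?A \<le> e" if e: "0 < e" for e
    proof -
      obtain J where J: "\<And>j. J \<le> j \<Longrightarrow> 6 * exp (- (ln 2 / 2) * real j) < e"
        using order_tendstoD(2)[OF lin e] unfolding eventually_sequentially by blast
      \<comment> \<open>The second term of the minimum forces j beyond J:
        \<open>wt 1 \<le> wt j < b * j\<close> yields \<open>J + 1 < j\<close>.\<close>
      define b where "b = min a (wt 1 / (real J + 1))"
      have b0: "0 < b" unfolding b_def using a0 wt_pos[of 1] by simp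
      obtain j where j: "1 \<le> j" "wt j < b * real j" using sub[OF b0] by blast
      have "wt 1 \<le> wt j" using wt_mono[of 1 j] j by simp
      also have "\<dots> < (wt 1 / (real J + 1)) * real j"
        using j(2) by (rule order.strict_trans2) (intro mult_right_mono, auto simp: b_def)
      finally have "wt 1 * (real J + 1) < wt 1 * real j" by (simp add: field_simps)
      then have "real J + 1 < real j"
        by (rule mult_left_less_imp_less) (use wt_pos[of 1] in simp)
      then have Jj: "J \<le> j" by simp
      have "wt j \<le> a * real j"
      proof -
        have "b * real j \<le> a * real j" by (intro mult_right_mono) (auto simp: b_def)
        then show ?thesis using j(2) by linarith
      qed
      then have "2 * real s * wt j \<le> 2 * real s * (a * real j)"
        by (intro mult_left_mono) auto
      also have "\<dots> = (real s / (real s + 1)) * (ln 2 / 2 * real j)"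
        unfolding a_def by (simp add: field_simps)
      also have "\<dots> \<le> 1 * (ln 2 / 2 * real j)"
        by (intro mult_right_mono) auto
      finally have ex: "2 * real s * wt j \<le> ln 2 / 2 * real j" by simp
      have "prob ?A \<le> 3 * exp (2 * real s * wt j) / 2 ^ (j - 1)"
        by (rule prob_clock_bounded) (use j in auto)
      also have "\<dots> \<le> 3 * exp (ln 2 / 2 * real j) / 2 ^ (j - 1)"
        using ex by (intro divide_right_mono mult_left_mono) auto
      also have "(2::real) ^ (j - 1) = exp (ln 2 * real j) / 2"
      proof -
        have "exp (ln 2 * real j) = (2::real) ^ j"
          by (simp add: exp_of_nat2_mult)
        then show ?thesis using j(1) by (cases j) auto
      qed
      also have "3 * exp (ln 2 / 2 * real j) / (exp (ln 2 * real j) / 2) = 6 * exp (- (ln 2 / 2) * real j)"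
      proof -
        have "exp (ln 2 * real j) = exp (ln 2 / 2 * real j) * exp (ln 2 / 2 * real j)"
          by (simp add: mult_exp_exp)
        then show ?thesis by (simp add: exp_minus field_simps)
      qed
      also have "\<dots> < e" using J[OF Jj] .
      finally show ?thesis by simp
    qed
    then have "prob ?A = 0" by (meson dense_ge measure_nonneg antisym)
    moreover have "?A \<in> sets M" by measurable
    ultimately have "?A \<in> null_sets M" by (simp add: emeasure_eq_measure null_sets_def)
    from AE_not_in[OF this] AE_space
    show "AE \<omega> in M. \<not> (\<forall>n. clock (hist n \<omega>) \<le> real s)"
      by eventually_elim auto
  qed
  then show ?thesis by eventually_elim (use clock_bounded in blast)
qed

section \<open>At most one colour is drawn infinitely often\<close>

definition bounded_count :: "nat \<Rightarrow> 'a \<Rightarrow> bool" where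
  "bounded_count c \<omega> \<longleftrightarrow> (\<exists>k. \<forall>n. hist_count (hist n \<omega>) c < k)"

lemma bounded_count_eventually_const:
  assumes "bounded_count c \<omega>"
  obtains k where "\<forall>\<^sub>F n in sequentially. hist_count (hist n \<omega>) c = k"
proof -
  let ?R = "range (\<lambda>n. hist_count (hist n \<omega>) c)"
  obtain b where "\<forall>n. hist_count (hist n \<omega>) c < b" using assms unfolding bounded_count_def by blast
  then have fin: "finite ?R" by (auto intro: finite_subset[of ?R "{..<b}"])
  then have "Max ?R \<in> ?R" by (intro Max_in) auto
  then obtain N where N: "Max ?R = hist_count (hist N \<omega>) c" by (rule rangeE)
  have "hist_count (hist n \<omega>) c = Max ?R" if "N \<le> n" for n
  proof (rule antisym)
    show "hist_count (hist n \<omega>) c \<le> Max ?R" by (rule Max_ge[OF fin]) (rule rangeI)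
    show "Max ?R \<le> hist_count (hist n \<omega>) c" unfolding N by (rule hist_count_hist_mono[OF that])
  qed
  then have "\<forall>\<^sub>F n in sequentially. hist_count (hist n \<omega>) c = Max ?R"
    by (rule eventually_sequentiallyI)
  then show ?thesis by (rule that)
qed

lemma unbounded_count_at_top:
  assumes "\<not> bounded_count c \<omega>"
  shows "filterlim (\<lambda>n. hist_count (hist n \<omega>) c) at_top sequentially"
proof (subst filterlim_at_top, intro allI)
  fix k
  obtain N where "k \<le> hist_count (hist N \<omega>) c"
    using assms unfolding bounded_count_def not_ex not_all not_less by blast
  then have "k \<le> hist_count (hist n \<omega>) c" if "N \<le> n" for n
    using hist_count_hist_mono[OF that, of \<omega> c] by simp
  then show "\<forall>\<^sub>F n in sequentially. k \<le> hist_count (hist n \<omega>) c"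
    by (rule eventually_sequentiallyI)
qed

text \<open>Reciprocal of the characteristic function at \<theta> of the embedded time to reach
  count k, just as \<open>growth\<close> inverts its Laplace transform.\<close>

definition complex_growth :: "real \<Rightarrow> nat \<Rightarrow> complex" where
  "complex_growth \<theta> k = (\<Prod>j\<in>{1..<k}. 1 - \<i> * of_real (\<theta> / wt j))"

lemma complex_growth_Suc: "1 \<le> k \<Longrightarrow> complex_growth \<theta> (Suc k) = complex_growth \<theta> k * (1 - \<i> * of_real (\<theta> / wt k))"
  unfolding complex_growth_def by (simp add: atLeastLessThanSuc)

lemma norm_one_minus_imaginary: "1 \<le> norm (1 - \<i> * of_real x)" "\<bar>x\<bar> \<le> norm (1 - \<i> * of_real x)"
  using abs_Re_le_cmod[of "1 - \<i> * of_real x"] abs_Im_le_cmod[of "1 - \<i> * of_real x"] by auto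

lemma norm_complex_growth_mono: "i \<le> j \<Longrightarrow> norm (complex_growth \<theta> i) \<le> norm (complex_growth \<theta> j)"
proof (rule lift_Suc_mono_le[of "\<lambda>n. norm (complex_growth \<theta> n)"])
  fix n
  show "norm (complex_growth \<theta> n) \<le> norm (complex_growth \<theta> (Suc n))"
  proof (cases "n = 0")
    case True
    then show ?thesis by (simp add: complex_growth_def)
  next
    case False
    then show ?thesis
      using mult_left_mono[OF norm_one_minus_imaginary(1) norm_ge_zero[of "complex_growth \<theta> n"]]
      by (simp add: complex_growth_Suc norm_mult del: of_real_divide)
  qed
qed

lemma norm_complex_growth_ge_1: "1 \<le> norm (complex_growth \<theta> k)"
  using norm_complex_growth_mono[of 0 k \<theta>] by (simp add: complex_growth_def)

text \<open>Draws of c have drift \<open>- \<i> * \<theta> / W h\<close> times the value; by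
  conjugation draws of c' have the opposite drift. The two cancel whatever the total weight
  is.\<close>

lemma complex_growth_pair_harmonic:
  assumes h: "h \<in> hists n" "1 \<le> n" and c: "c \<in> set h" "c' \<in> set h" "c \<noteq> c'"
  shows "step (\<lambda>h. complex_growth \<theta> (hist_count h c) * cnj (complex_growth \<theta> (hist_count h c'))) h
     = complex_growth \<theta> (hist_count h c) * cnj (complex_growth \<theta> (hist_count h c'))"
proof -
  let ?f = "\<lambda>h. complex_growth \<theta> (hist_count h c) * cnj (complex_growth \<theta> (hist_count h c'))"
  have ne: "h \<noteq> []" using c by auto
  have new: "Suc (card (set h)) \<noteq> c" "Suc (card (set h)) \<noteq> c'" using new_notin_hists[OF h(1)] c by auto
  have cnt: "1 \<le> hist_count h c" "1 \<le> hist_count h c'" using c hist_count_pos_iff[of h] by (simp_all add: Suc_le_eq)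
  have Wp: "W h \<noteq> 0" using W_pos[OF ne] by simp
  have wc: "wt (hist_count h c) \<noteq> 0" "wt (hist_count h c') \<noteq> 0" using wt_count_pos c by (simp_all add: less_imp_neq[symmetric])
  define a where "a = complex_of_real (\<theta> / W h) * (\<i> * ?f h)"
  have s1: "(wt (hist_count h c) / W h) *\<^sub>R (?f (h @ [c]) - ?f h) = - a"
  proof -
    have "?f (h @ [c]) - ?f h = of_real (\<theta> / wt (hist_count h c)) * (- (\<i> * ?f h))"
      using c(3) cnt by (simp add: complex_growth_Suc algebra_simps del: of_real_divide)
    then have "(wt (hist_count h c) / W h) *\<^sub>R (?f (h @ [c]) - ?f h)
       = of_real ((wt (hist_count h c) / W h) * (\<theta> / wt (hist_count h c))) * (- (\<i> * ?f h))"
      by (simp only: scaleR_conv_of_real of_real_mult mult.assoc)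
    also have "(wt (hist_count h c) / W h) * (\<theta> / wt (hist_count h c)) = \<theta> / W h" using wc by simp
    finally show ?thesis unfolding a_def by simp
  qed
  have s2: "(wt (hist_count h c') / W h) *\<^sub>R (?f (h @ [c']) - ?f h) = a"
  proof -
    have "?f (h @ [c']) - ?f h = of_real (\<theta> / wt (hist_count h c')) * (\<i> * ?f h)"
      using c(3) cnt by (simp add: complex_growth_Suc algebra_simps del: of_real_divide)
    then have "(wt (hist_count h c') / W h) *\<^sub>R (?f (h @ [c']) - ?f h)
       = of_real ((wt (hist_count h c') / W h) * (\<theta> / wt (hist_count h c'))) * (\<i> * ?f h)"
      by (simp only: scaleR_conv_of_real of_real_mult mult.assoc)
    also have "(wt (hist_count h c') / W h) * (\<theta> / wt (hist_count h c')) = \<theta> / W h" using wc by simp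
    finally show ?thesis unfolding a_def by simp
  qed
  have "(wt (hist_count h x) / W h) *\<^sub>R (?f (h @ [x]) - ?f h) = (if x = c then - a else 0) + (if x = c' then a else 0)" for x
  proof -
    consider "x = c" | "x = c'" | "x \<noteq> c" "x \<noteq> c'" by blast
    then show ?thesis
    proof cases
      case 1 then show ?thesis using s1 c(3) by simp
    next
      case 2 then show ?thesis using s2 c(3) by simp
    qed simp
  qed
  then have "(\<Sum>x\<in>set h. (wt (hist_count h x) / W h) *\<^sub>R (?f (h @ [x]) - ?f h)) = 0"
    using c by (simp add: sum.distrib)
  then have "step ?f h - ?f h = 0"
    using step_diff[OF ne, of ?f] new by simp
  then show ?thesis by simp
qed

lemma complex_growth_convergent:
  assumes "summable (\<lambda>k. 1 / wt (Suc k))"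
  obtains l where "complex_growth \<theta> \<longlonglongrightarrow> l"
proof -
  have "summable (\<lambda>k. \<bar>\<theta>\<bar> * (1 / wt (Suc k)))" using assms by (rule summable_mult)
  moreover have "norm ((1 - \<i> * of_real (\<theta> / wt (Suc k))) - 1) = \<bar>\<theta>\<bar> * (1 / wt (Suc k))" for k
    using wt_pos[of "Suc k"] by (simp add: norm_mult norm_divide)
  ultimately have "abs_convergent_prod (\<lambda>k. 1 - \<i> * of_real (\<theta> / wt (Suc k)))"
    by (simp add: abs_convergent_prod_conv_summable)
  then have "convergent_prod (\<lambda>k. 1 - \<i> * of_real (\<theta> / wt (Suc k)))"
    by (rule abs_convergent_prod_imp_convergent_prod)
  then have *: "(\<lambda>n. \<Prod>k\<le>n. 1 - \<i> * of_real (\<theta> / wt (Suc k))) \<longlonglongrightarrow> prodinf (\<lambda>k. 1 - \<i> * of_real (\<theta> / wt (Suc k)))"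
    by (rule convergent_prod_LIMSEQ)
  have "(\<Prod>k\<le>n. 1 - \<i> * of_real (\<theta> / wt (Suc k))) = complex_growth \<theta> (n + 2)" for n
    unfolding complex_growth_def by (rule prod.reindex_bij_witness[of _ "\<lambda>i. i - 1" Suc]) auto
  with * have "(\<lambda>n. complex_growth \<theta> (n + 2)) \<longlonglongrightarrow> prodinf (\<lambda>k. 1 - \<i> * of_real (\<theta> / wt (Suc k)))"
    by (simp only:)
  then have "complex_growth \<theta> \<longlonglongrightarrow> prodinf (\<lambda>k. 1 - \<i> * of_real (\<theta> / wt (Suc k)))"
    by (rule LIMSEQ_offset)
  then show ?thesis by (rule that)
qed

text \<open>Two limits in succession: first time tends to infinity at fixed \<theta>, where the
  martingale is bounded, then \<theta> tends to infinity along the integers. After division by the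
  bound \<open>norm (L \<theta>) ^ 2\<close> the limit becomes the indicator that both counts
  diverge, while the expectation, known at time m, tends to 0.\<close>

lemma AE_bounded_pair:
  assumes sm: "summable (\<lambda>k. 1 / wt (Suc k))" and cc: "c \<noteq> c'" and m: "1 \<le> m"
  shows "AE \<omega> in M. c \<in> set (hist m \<omega>) \<longrightarrow> c' \<in> set (hist m \<omega>) \<longrightarrow> bounded_count c \<omega> \<or> bounded_count c' \<omega>"
proof -
  \<comment> \<open>Presence of both colours is tested at the fixed time m, because the two drifts
    cancel only once both are born.\<close>
  define E where "E h \<longleftrightarrow> c \<in> set (take m h) \<and> c' \<in> set (take m h)" for h
  define f where "f \<theta> h = (if E h then complex_growth \<theta> (hist_count h c) * cnj (complex_growth \<theta> (hist_count h c')) else 0)" for \<theta> h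
  have "\<forall>\<theta>. \<exists>l. complex_growth \<theta> \<longlonglongrightarrow> l" using complex_growth_convergent[OF sm] by blast
  then obtain L where L: "complex_growth \<theta> \<longlonglongrightarrow> L \<theta>" for \<theta> by metis
  \<comment> \<open>The moduli increase with the count, so their limit serves both as dominating
    constant and as normaliser.\<close>
  have leL: "norm (complex_growth \<theta> k) \<le> norm (L \<theta>)" for \<theta> k
    by (rule incseq_le[OF _ tendsto_norm[OF L]]) (simp add: incseq_def norm_complex_growth_mono)
  have L1: "1 \<le> norm (L \<theta>)" for \<theta> using leL[of \<theta> 0] norm_complex_growth_ge_1[of \<theta> 0] by simp
  have Ediff: "E (hist n \<omega>) \<longleftrightarrow> E (hist m \<omega>)" if "m \<le> n" for n \<omega>
    unfolding E_def using that by (simp add: take_hist)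
  have const: "(\<integral>\<omega>. f \<theta> (hist (m + n) \<omega>) \<partial>M) = (\<integral>\<omega>. f \<theta> (hist m \<omega>) \<partial>M)" for \<theta> n
  proof (induction n)
    case (Suc n)
    have "(\<integral>\<omega>. f \<theta> (hist (Suc (m + n)) \<omega>) \<partial>M) = (\<integral>\<omega>. step (f \<theta>) (hist (m + n) \<omega>) \<partial>M)"
      using m by (intro integral_hist_Suc) simp
    also have "\<dots> = (\<integral>\<omega>. f \<theta> (hist (m + n) \<omega>) \<partial>M)"
    proof (rule integral_hist_cong)
      fix h assume h: "h \<in> hists (m + n)"
      have Esnoc: "E (h @ [x]) = E h" for x using length_hists[OF h] by (simp add: E_def)
      show "step (f \<theta>) h = f \<theta> h"
      proof (cases "E h")
        case True
        then have "c \<in> set h" "c' \<in> set h" unfolding E_def using set_take_subset by fast+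
        from complex_growth_pair_harmonic[OF h _ this cc, of \<theta>] True m show ?thesis
          unfolding step_def f_def Esnoc by simp
      next
        case False
        then show ?thesis unfolding step_def f_def Esnoc by simp
      qed
    qed
    finally show ?case using Suc by simp
  qed simp
  \<comment> \<open>The limit along the path: \<open>L \<theta>\<close> if the count diverges, and
    the value at the final count otherwise.\<close>
  define \<Psi> where "\<Psi> \<theta> x \<omega> = lim (\<lambda>n. complex_growth \<theta> (hist_count (hist n \<omega>) x))" for \<theta> x \<omega>
  have \<Psi>_bdd: "(\<lambda>n. complex_growth \<theta> (hist_count (hist n \<omega>) x)) \<longlonglongrightarrow> complex_growth \<theta> k \<and> \<Psi> \<theta> x \<omega> = complex_growth \<theta> k"
    if "\<forall>\<^sub>F n in sequentially. hist_count (hist n \<omega>) x = k" for \<theta> x \<omega> k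
  proof -
    have "(\<lambda>n. complex_growth \<theta> (hist_count (hist n \<omega>) x)) \<longlonglongrightarrow> complex_growth \<theta> k"
      by (rule tendsto_eventually) (use that in eventually_elim, simp)
    then show ?thesis unfolding \<Psi>_def by (simp add: limI)
  qed
  have \<Psi>_unbdd: "(\<lambda>n. complex_growth \<theta> (hist_count (hist n \<omega>) x)) \<longlonglongrightarrow> L \<theta> \<and> \<Psi> \<theta> x \<omega> = L \<theta>"
    if "\<not> bounded_count x \<omega>" for \<theta> x \<omega>
  proof -
    have "(\<lambda>n. complex_growth \<theta> (hist_count (hist n \<omega>) x)) \<longlonglongrightarrow> L \<theta>"
      by (rule filterlim_compose[OF L unbounded_count_at_top[OF that]])
    then show ?thesis unfolding \<Psi>_def by (simp add: limI)
  qed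
  have \<Psi>_lim: "(\<lambda>n. complex_growth \<theta> (hist_count (hist n \<omega>) x)) \<longlonglongrightarrow> \<Psi> \<theta> x \<omega>" for \<theta> x \<omega>
  proof (cases "bounded_count x \<omega>")
    case True
    then obtain k where k: "\<forall>\<^sub>F n in sequentially. hist_count (hist n \<omega>) x = k"
      by (rule bounded_count_eventually_const)
    show ?thesis using \<Psi>_bdd[OF k, of \<theta>] by simp
  next
    case False
    show ?thesis using \<Psi>_unbdd[OF False, of \<theta>] by simp
  qed
  have \<Psi>_le: "norm (\<Psi> \<theta> x \<omega>) \<le> norm (L \<theta>)" for \<theta> x \<omega>
    by (rule LIMSEQ_le_const2[OF tendsto_norm[OF \<Psi>_lim]]) (use leL in blast)
  have meas [measurable]: "(\<lambda>\<omega>. g (hist n \<omega>)) \<in> borel_measurable M" for g :: "nat list \<Rightarrow> complex" and n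
    by (rule measurable_compose[OF hist_meas]) simp
  have [measurable]: "(\<lambda>\<omega>. \<Psi> \<theta> x \<omega>) \<in> borel_measurable M" for \<theta> x
    unfolding \<Psi>_def by (rule borel_measurable_lim_metric) (rule meas)
  define g where "g \<theta> \<omega> = (if E (hist m \<omega>) then \<Psi> \<theta> c \<omega> * cnj (\<Psi> \<theta> c' \<omega>) else 0)" for \<theta> \<omega>
  have [measurable]: "g \<theta> \<in> borel_measurable M" for \<theta>
  proof -
    have cnj: "cnj \<in> borel_measurable borel"
      by (rule borel_measurable_continuous_onI) (intro continuous_intros)
    have "(\<lambda>\<omega>. \<Psi> \<theta> c \<omega> * cnj (\<Psi> \<theta> c' \<omega>)) \<in> borel_measurable M"
      by (rule borel_measurable_times[OF _ measurable_compose[OF _ cnj]]) measurable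
    moreover have "Measurable.pred M (\<lambda>\<omega>. E (hist m \<omega>))" by measurable
    ultimately show ?thesis unfolding g_def[abs_def] by (intro measurable_If) (simp_all add: pred_def)
  qed
  have int_g: "(\<integral>\<omega>. g \<theta> \<omega> \<partial>M) = (\<integral>\<omega>. f \<theta> (hist m \<omega>) \<partial>M)" for \<theta>
  proof -
    have "(\<lambda>n. \<integral>\<omega>. f \<theta> (hist (m + n) \<omega>) \<partial>M) \<longlonglongrightarrow> (\<integral>\<omega>. g \<theta> \<omega> \<partial>M)"
    proof (rule integral_dominated_convergence[where w="\<lambda>_. norm (L \<theta>) * norm (L \<theta>)"])
      show "AE \<omega> in M. (\<lambda>n. f \<theta> (hist (m + n) \<omega>)) \<longlonglongrightarrow> g \<theta> \<omega>"
      proof (rule AE_I2)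
        fix \<omega>
        have "(\<lambda>n. complex_growth \<theta> (hist_count (hist n \<omega>) c) * cnj (complex_growth \<theta> (hist_count (hist n \<omega>) c')))
           \<longlonglongrightarrow> \<Psi> \<theta> c \<omega> * cnj (\<Psi> \<theta> c' \<omega>)"
          by (intro tendsto_mult tendsto_cnj \<Psi>_lim)
        from LIMSEQ_ignore_initial_segment[OF this, of m]
        have "(\<lambda>n. complex_growth \<theta> (hist_count (hist (m + n) \<omega>) c) * cnj (complex_growth \<theta> (hist_count (hist (m + n) \<omega>) c')))
           \<longlonglongrightarrow> \<Psi> \<theta> c \<omega> * cnj (\<Psi> \<theta> c' \<omega>)"
          by (simp only: add.commute)
        then show "(\<lambda>n. f \<theta> (hist (m + n) \<omega>)) \<longlonglongrightarrow> g \<theta> \<omega>"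
          unfolding f_def g_def by (simp add: Ediff[OF le_add1])
      qed
      show "AE \<omega> in M. norm (f \<theta> (hist (m + n) \<omega>)) \<le> norm (L \<theta>) * norm (L \<theta>)" for n
      proof (rule AE_I2)
        fix \<omega>
        have "norm (complex_growth \<theta> i * cnj (complex_growth \<theta> j)) \<le> norm (L \<theta>) * norm (L \<theta>)" for i j
          unfolding norm_mult complex_mod_cnj by (intro mult_mono leL norm_ge_zero)
        then show "norm (f \<theta> (hist (m + n) \<omega>)) \<le> norm (L \<theta>) * norm (L \<theta>)"
          unfolding f_def by simp
      qed
    qed (simp, rule meas, simp)
    then have "(\<lambda>n::nat. \<integral>\<omega>. f \<theta> (hist m \<omega>) \<partial>M) \<longlonglongrightarrow> (\<integral>\<omega>. g \<theta> \<omega> \<partial>M)"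
      by (simp only: const)
    from LIMSEQ_unique[OF this tendsto_const] show ?thesis .
  qed
  define I where "I \<omega> \<longleftrightarrow> E (hist m \<omega>) \<and> \<not> bounded_count c \<omega> \<and> \<not> bounded_count c' \<omega>" for \<omega>
  have bm [measurable]: "Measurable.pred M (bounded_count x)" for x
    unfolding bounded_count_def by measurable
  have [measurable]: "Measurable.pred M I"
    unfolding I_def by measurable
  \<comment> \<open>On \<open>I\<close> the quotient equals 1 for every n. If both colours are
    present and one count stops at k, the factor with index k is missing from the numerator, which
    already makes the quotient of order 1/n.\<close>
  have lim1: "(\<lambda>n. \<integral>\<omega>. g (real n) \<omega> / of_real (norm (L (real n)) ^ 2) \<partial>M) \<longlonglongrightarrow> (\<integral>\<omega>. of_bool (I \<omega>) \<partial>M)"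
  proof (rule integral_dominated_convergence[where w="\<lambda>_. 1"])
    have aux: "x / y ^ 2 \<le> a / y" if "x \<le> a * y" "1 \<le> y" for x y a :: real
    proof -
      have "x / y ^ 2 \<le> a * y / y ^ 2" using that by (intro divide_right_mono) auto
      also have "\<dots> = a / y" using that by (simp add: power2_eq_square)
      finally show ?thesis .
    qed
    have g_le: "norm (g (real n) \<omega>) / norm (L (real n)) ^ 2 \<le> norm (\<Psi> (real n) c \<omega>) / norm (L (real n))"
       "norm (g (real n) \<omega>) / norm (L (real n)) ^ 2 \<le> norm (\<Psi> (real n) c' \<omega>) / norm (L (real n))" for n \<omega>
    proof -
      have "norm (g (real n) \<omega>) \<le> norm (\<Psi> (real n) c \<omega>) * norm (L (real n))"
        "norm (g (real n) \<omega>) \<le> norm (L (real n)) * norm (\<Psi> (real n) c' \<omega>)"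
        unfolding g_def using \<Psi>_le by (auto simp: norm_mult intro!: mult_mono)
      then show "norm (g (real n) \<omega>) / norm (L (real n)) ^ 2 \<le> norm (\<Psi> (real n) c \<omega>) / norm (L (real n))"
       "norm (g (real n) \<omega>) / norm (L (real n)) ^ 2 \<le> norm (\<Psi> (real n) c' \<omega>) / norm (L (real n))"
        using aux L1[of "real n"] by (simp_all add: mult.commute)
    qed
    have small: "(\<lambda>n. norm (g (real n) \<omega>) / norm (L (real n)) ^ 2) \<longlonglongrightarrow> 0"
      if x: "x = c \<or> x = c'" and b: "bounded_count x \<omega>" and e: "E (hist m \<omega>)" for \<omega> x
    proof -
      obtain k where k: "\<forall>\<^sub>F n in sequentially. hist_count (hist n \<omega>) x = k"
        using bounded_count_eventually_const[OF b] .
      have "1 \<le> k"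
      proof -
        obtain n where n: "hist_count (hist n \<omega>) x = k" "m \<le> n"
          using eventually_happens'[OF sequentially_bot eventually_conj[OF k eventually_ge_at_top[of m]]] by blast
        have "0 < hist_count (hist m \<omega>) x" using e x unfolding E_def hist_count_pos_iff by auto
        then show ?thesis using hist_count_hist_mono[OF n(2), of \<omega> x] n(1) by simp
      qed
      have "norm (g (real n) \<omega>) / norm (L (real n)) ^ 2 \<le> wt k * (1 / real n)" if "1 \<le> n" for n
      proof -
        have "norm (g (real n) \<omega>) / norm (L (real n)) ^ 2 \<le> norm (\<Psi> (real n) x \<omega>) / norm (L (real n))"
          using g_le x by blast
        also have "\<dots> \<le> norm (complex_growth (real n) k) / norm (complex_growth (real n) (Suc k))"
          using \<Psi>_bdd[OF k] leL[of "real n" "Suc k"] norm_complex_growth_ge_1[of "real n" "Suc k"]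
          by (auto intro!: divide_left_mono mult_pos_pos)
        also have "\<dots> = 1 / norm (1 - \<i> * of_real (real n / wt k))"
        proof -
          have "norm (complex_growth (real n) k) \<noteq> 0" using norm_complex_growth_ge_1[of "real n" k] by linarith
          then show ?thesis by (simp add: complex_growth_Suc[OF \<open>1 \<le> k\<close>] norm_mult del: of_real_divide)
        qed
        also have "\<dots> \<le> 1 / \<bar>real n / wt k\<bar>"
          using norm_one_minus_imaginary[of "real n / wt k"] that wt_pos[OF \<open>1 \<le> k\<close>]
          by (intro divide_left_mono) (auto intro!: mult_pos_pos)
        finally show ?thesis using wt_pos[OF \<open>1 \<le> k\<close>] by simp
      qed
      then have "\<forall>\<^sub>F n in sequentially. norm (norm (g (real n) \<omega>) / norm (L (real n)) ^ 2) \<le> wt k * (1 / real n)"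
        by (intro eventually_sequentiallyI[of 1]) simp
      moreover have "(\<lambda>n. wt k * (1 / real n)) \<longlonglongrightarrow> 0"
        using tendsto_mult[OF tendsto_const lim_1_over_n, of "wt k"] by simp
      ultimately show ?thesis by (rule Lim_null_comparison)
    qed
    show "AE \<omega> in M. (\<lambda>n. g (real n) \<omega> / of_real (norm (L (real n)) ^ 2)) \<longlonglongrightarrow> of_bool (I \<omega>)"
    proof (rule AE_I2)
      fix \<omega>
      show "(\<lambda>n. g (real n) \<omega> / of_real (norm (L (real n)) ^ 2)) \<longlonglongrightarrow> of_bool (I \<omega>)"
      proof (cases "I \<omega>")
        case True
        have "g (real n) \<omega> / of_real (norm (L (real n)) ^ 2) = 1" for n
        proof -
          have "g (real n) \<omega> = L (real n) * cnj (L (real n))"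
            using True \<Psi>_unbdd unfolding g_def I_def by simp
          also have "\<dots> = of_real (norm (L (real n)) ^ 2)" by (rule complex_norm_square[symmetric])
          finally have "g (real n) \<omega> = of_real (norm (L (real n)) ^ 2)" .
          moreover have "norm (L (real n)) \<noteq> 0" using L1[of "real n"] by linarith
          ultimately show ?thesis by simp
        qed
        then show ?thesis using True by simp
      next
        case False
        have "(\<lambda>n. norm (g (real n) \<omega>) / norm (L (real n)) ^ 2) \<longlonglongrightarrow> 0"
        proof (cases "E (hist m \<omega>)")
          case True
          then show ?thesis using False small unfolding I_def by blast
        next
          case False
          then show ?thesis by (simp add: g_def)
        qed
        then have "(\<lambda>n. norm (g (real n) \<omega> / of_real (norm (L (real n)) ^ 2))) \<longlonglongrightarrow> 0"
          by (simp add: norm_divide norm_power)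
        then show ?thesis using False by (simp add: tendsto_norm_zero_iff)
      qed
    qed
    show "AE \<omega> in M. norm (g (real n) \<omega> / of_real (norm (L (real n)) ^ 2)) \<le> 1" for n
    proof (rule AE_I2)
      fix \<omega>
      have "norm (g (real n) \<omega>) / norm (L (real n)) ^ 2 \<le> norm (\<Psi> (real n) c \<omega>) / norm (L (real n))"
        by (rule g_le)
      also have "\<dots> \<le> 1" using \<Psi>_le[of "real n" c \<omega>] L1[of "real n"] by (simp add: divide_le_eq)
      finally show "norm (g (real n) \<omega> / of_real (norm (L (real n)) ^ 2)) \<le> 1"
        by (simp add: norm_divide norm_power)
    qed
  qed simp_all
  \<comment> \<open>At time m no count exceeds \<open>Suc m\<close>, so the factor with index
    \<open>Suc m\<close> is missing from the initial value and the quotient is again of order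
    1/n.\<close>
  have lim2: "(\<lambda>n. \<integral>\<omega>. g (real n) \<omega> / of_real (norm (L (real n)) ^ 2) \<partial>M) \<longlonglongrightarrow> 0"
  proof (rule Lim_null_comparison)
    show "(\<lambda>n. wt (Suc m) * (1 / real n)) \<longlonglongrightarrow> 0"
      using tendsto_mult[OF tendsto_const lim_1_over_n, of "wt (Suc m)"] by simp
    have "norm (\<integral>\<omega>. g (real n) \<omega> / of_real (norm (L (real n)) ^ 2) \<partial>M) \<le> wt (Suc m) * (1 / real n)"
      if "1 \<le> n" for n
    proof -
      have f_le: "norm (f (real n) h) \<le> norm (complex_growth (real n) (Suc m)) * norm (L (real n))" if "h \<in> hists m" for h
      proof -
        have "hist_count h c \<le> Suc m" using hist_count_le_length[of h c] length_hists[OF that] by simp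
        then show ?thesis unfolding f_def
          by (auto simp: norm_mult intro!: mult_mono norm_complex_growth_mono leL)
      qed
      have "norm (\<integral>\<omega>. f (real n) (hist m \<omega>) \<partial>M) \<le> (\<integral>\<omega>. norm (f (real n) (hist m \<omega>)) \<partial>M)"
        by (rule integral_norm_bound)
      also have "\<dots> \<le> (\<integral>\<omega>. norm (complex_growth (real n) (Suc m)) * norm (L (real n)) \<partial>M)"
        by (rule integral_hist_mono[where f="\<lambda>h. norm (f (real n) h)" and g="\<lambda>_. norm (complex_growth (real n) (Suc m)) * norm (L (real n))"])
          (rule f_le)
      also have "\<dots> = norm (complex_growth (real n) (Suc m)) * norm (L (real n))"
        by (simp add: prob_space)
      finally have "norm (\<integral>\<omega>. g (real n) \<omega> / of_real (norm (L (real n)) ^ 2) \<partial>M)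
          \<le> norm (complex_growth (real n) (Suc m)) * norm (L (real n)) / norm (L (real n)) ^ 2"
        unfolding int_g[symmetric] by (simp add: norm_divide norm_power divide_right_mono)
      also have "\<dots> = norm (complex_growth (real n) (Suc m)) / norm (L (real n))"
        using L1[of "real n"] by (simp add: power2_eq_square)
      also have "\<dots> \<le> norm (complex_growth (real n) (Suc m)) / norm (complex_growth (real n) (Suc (Suc m)))"
        using leL[of "real n" "Suc (Suc m)"] norm_complex_growth_ge_1[of "real n" "Suc (Suc m)"]
        by (intro divide_left_mono mult_pos_pos) auto
      also have "\<dots> = 1 / norm (1 - \<i> * of_real (real n / wt (Suc m)))"
      proof -
        have "norm (complex_growth (real n) (Suc m)) \<noteq> 0" using norm_complex_growth_ge_1[of "real n" "Suc m"] by linarith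
        then show ?thesis by (simp add: complex_growth_Suc[of "Suc m"] norm_mult del: of_real_divide)
      qed
      also have "\<dots> \<le> 1 / \<bar>real n / wt (Suc m)\<bar>"
        using norm_one_minus_imaginary[of "real n / wt (Suc m)"] that wt_pos[of "Suc m"]
        by (intro divide_left_mono) (auto intro!: mult_pos_pos)
      finally show ?thesis using wt_pos[of "Suc m"] by simp
    qed
    then show "\<forall>\<^sub>F n in sequentially. norm (\<integral>\<omega>. g (real n) \<omega> / of_real (norm (L (real n)) ^ 2) \<partial>M) \<le> wt (Suc m) * (1 / real n)"
      by (intro eventually_sequentiallyI[of 1]) simp
  qed
  have "complex_of_real (\<integral>\<omega>. of_bool (I \<omega>) \<partial>M) = 0"
  proof -
    have "(\<lambda>\<omega>. complex_of_real (of_bool (I \<omega>))) = (\<lambda>\<omega>. of_bool (I \<omega>) :: complex)"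
      by (auto simp: of_bool_def)
    then show ?thesis
      using LIMSEQ_unique[OF lim1 lim2] integral_complex_of_real[of M "\<lambda>\<omega>. of_bool (I \<omega>)"] by argo
  qed
  then have 0: "(\<integral>\<omega>. of_bool (I \<omega>) \<partial>M) = (0::real)" by simp
  define A where "A = {\<omega>\<in>space M. I \<omega>}"
  have "A \<in> sets M" unfolding A_def by measurable
  moreover have "prob A = 0"
  proof -
    have "(\<integral>\<omega>. of_bool (I \<omega>) \<partial>M) = (\<integral>\<omega>. indicator A \<omega> \<partial>M :: real)"
      by (intro Bochner_Integration.integral_cong) (auto simp: indicator_def A_def)
    moreover have "A \<inter> space M = A" unfolding A_def by blast
    ultimately show ?thesis using 0 by simp
  qed
  ultimately have "A \<in> null_sets M" by (simp add: emeasure_eq_measure null_sets_def)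
  from AE_not_in[OF this] AE_space show ?thesis
    by eventually_elim (auto simp: A_def I_def E_def take_hist)
qed

lemma AE_at_most_one_unbounded:
  assumes sm: "summable (\<lambda>k. 1 / wt (Suc k))"
  shows "AE \<omega> in M. \<forall>c c'. c \<noteq> c' \<longrightarrow> bounded_count c \<omega> \<or> bounded_count c' \<omega>"
proof -
  have "AE \<omega> in M. \<forall>c c' m. c \<noteq> c' \<longrightarrow> 1 \<le> m \<longrightarrow> c \<in> set (hist m \<omega>) \<longrightarrow> c' \<in> set (hist m \<omega>)
      \<longrightarrow> bounded_count c \<omega> \<or> bounded_count c' \<omega>"
    unfolding AE_all_countable
  proof (intro allI)
    fix c c' m :: nat
    show "AE \<omega> in M. c \<noteq> c' \<longrightarrow> 1 \<le> m \<longrightarrow> c \<in> set (hist m \<omega>) \<longrightarrow> c' \<in> set (hist m \<omega>)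
      \<longrightarrow> bounded_count c \<omega> \<or> bounded_count c' \<omega>"
    proof (cases "c \<noteq> c' \<and> 1 \<le> m")
      case True
      then show ?thesis using AE_bounded_pair[OF sm, of c c' m] by simp
    next
      case False
      then show ?thesis by (intro AE_I2) blast
    qed
  qed
  then show ?thesis
  proof eventually_elim
    case (elim \<omega>)
    show ?case
    proof (intro allI impI, rule ccontr)
      fix c c' :: nat
      assume cc: "c \<noteq> c'"
        and u: "\<not> (bounded_count c \<omega> \<or> bounded_count c' \<omega>)"
      have ev: "\<forall>\<^sub>F n in sequentially. 1 \<le> hist_count (hist n \<omega>) x" if "\<not> bounded_count x \<omega>" for x
        using unbounded_count_at_top[OF that] unfolding filterlim_at_top by (rule spec)
      have "\<forall>\<^sub>F n in sequentially. 1 \<le> hist_count (hist n \<omega>) c"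
        "\<forall>\<^sub>F n in sequentially. 1 \<le> hist_count (hist n \<omega>) c'"
        by (rule ev, use u in simp)+
      with eventually_ge_at_top[of "1::nat"]
      have "\<forall>\<^sub>F n in sequentially. 1 \<le> n \<and> 1 \<le> hist_count (hist n \<omega>) c \<and> 1 \<le> hist_count (hist n \<omega>) c'"
        by (intro eventually_conj)
      from eventually_happens'[OF sequentially_bot this]
      obtain n where n: "1 \<le> n" "1 \<le> hist_count (hist n \<omega>) c" "1 \<le> hist_count (hist n \<omega>) c'"
        by blast
      have "c \<in> set (hist n \<omega>)" "c' \<in> set (hist n \<omega>)"
        using n(2,3) by (simp_all add: hist_count_pos_iff[symmetric])
      with elim cc u n(1) show False by blast
    qed
  qed
qed

section \<open>Pursuit of a leading colour\<close>

lemma growth_split: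
  assumes "1 \<le> i" "i \<le> m"
  shows "growth \<kappa> m = growth \<kappa> i * (\<Prod>j\<in>{i..<m}. 1 + \<kappa> / wt j)"
proof -
  have "{1..<m} = {1..<i} \<union> {i..<m}" using assms by auto
  then show ?thesis unfolding growth_def by (simp add: prod.union_disjoint)
qed

lemma one_plus_rate_mono:
  assumes "0 \<le> \<kappa>" "\<kappa> \<le> \<kappa>'" "1 \<le> j"
  shows "1 \<le> 1 + \<kappa> / wt j" "1 + \<kappa> / wt j \<le> 1 + \<kappa>' / wt j"
  using assms wt_pos[of j] by (auto intro: divide_right_mono)

lemma growth_mono_rate:
  assumes "0 \<le> \<kappa>" "\<kappa> \<le> \<kappa>'"
  shows "growth \<kappa> k \<le> growth \<kappa>' k"
  unfolding growth_def
proof (intro prod_mono conjI)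
  fix i assume "i \<in> {1..<k}"
  then have "1 \<le> i" by simp
  from one_plus_rate_mono[OF assms this]
  show "0 \<le> 1 + \<kappa> / wt i" "1 + \<kappa> / wt i \<le> 1 + \<kappa>' / wt i" by linarith+
qed

text \<open>Each quotient is the reciprocal of the product of the factors from i up to the end, and
  that product increases with the rate and with the end.\<close>

lemma growth_ratio_mono:
  assumes k: "0 \<le> \<kappa>" "\<kappa> \<le> \<kappa>'" and i: "1 \<le> i" "i \<le> m" "m \<le> n"
  shows "growth \<kappa>' i / growth \<kappa>' n \<le> growth \<kappa> i / growth \<kappa> m"
proof -
  have k': "0 \<le> \<kappa>'" using k by simp
  let ?P = "\<lambda>\<kappa> m. \<Prod>j\<in>{i..<m}. 1 + \<kappa> / wt j"
  have "1 \<le> ?P \<kappa> m"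
    using i one_plus_rate_mono(1)[OF k] by (intro prod_ge_1) auto
  then have pos: "0 < ?P \<kappa> m" by simp
  have "?P \<kappa> m \<le> ?P \<kappa>' m"
  proof (intro prod_mono conjI)
    fix j assume "j \<in> {i..<m}"
    then have "1 \<le> j" using i by simp
    from one_plus_rate_mono[OF k this]
    show "0 \<le> 1 + \<kappa> / wt j" "1 + \<kappa> / wt j \<le> 1 + \<kappa>' / wt j" by linarith+
  qed
  also have "\<dots> \<le> ?P \<kappa>' n"
  proof (rule prod_mono2)
    fix j assume "j \<in> {i..<n} - {i..<m}"
    then have "1 \<le> j" using i by auto
    from one_plus_rate_mono(1)[OF k' order_refl this] show "1 \<le> 1 + \<kappa>' / wt j" .
  next
    fix j assume "j \<in> {i..<m}"
    then have "1 \<le> j" using i by simp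
    from one_plus_rate_mono(1)[OF k' order_refl this] show "0 \<le> 1 + \<kappa>' / wt j" by linarith
  qed (use i in auto)
  finally have le: "?P \<kappa> m \<le> ?P \<kappa>' n" .
  have "growth \<kappa>' i / growth \<kappa>' n = 1 / ?P \<kappa>' n"
    using growth_split[of i n \<kappa>'] growth_pos[OF k', of i] i by simp
  also have "\<dots> \<le> 1 / ?P \<kappa> m"
    using le pos by (intro divide_left_mono mult_pos_pos) auto
  also have "\<dots> = growth \<kappa> i / growth \<kappa> m"
    using growth_split[of i m \<kappa>] growth_pos[OF k(1), of i] i by simp
  finally show ?thesis .
qed

text \<open>In a convergent series with decreasing terms, n times the n-th term tends to 0: the
  terms between N and n are all at least \<open>1 / W\<close> at time n.\<close>

lemma W_superlinear:
  assumes sm: "summable (\<lambda>n. 1 / W (hist (Suc n) \<omega>))"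
  shows "\<exists>N. \<forall>n\<ge>N. C * real n \<le> W (hist n \<omega>)"
proof -
  \<comment> \<open>The maximum keeps D positive for arbitrary C. The 2 in \<open>2 * D\<close> is
    used up by \<open>n \<le> 2 * (n - N)\<close> for n beyond \<open>2 * N\<close>.\<close>
  define D where "D = max C 1"
  have D: "0 < D" "C \<le> D" unfolding D_def by auto
  obtain N where N: "\<And>n. N \<le> n \<Longrightarrow> norm (\<Sum>i. 1 / W (hist (Suc (i + n)) \<omega>)) < 1 / (2 * D)"
    using suminf_exist_split[OF _ sm, of "1 / (2 * D)"] D by auto
  have "C * real n \<le> W (hist n \<omega>)" if n: "2 * N + 1 \<le> n" for n
  proof -
    have Wn: "0 < W (hist n \<omega>)" using n by (intro W_pos) (auto simp: hist_def)
    have sm': "summable (\<lambda>i. 1 / W (hist (Suc (i + N)) \<omega>))"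
      using sm by (rule summable_ignore_initial_segment)
    have "real (n - N) * (1 / W (hist n \<omega>)) = (\<Sum>i<n-N. 1 / W (hist n \<omega>))" by simp
    also have "\<dots> \<le> (\<Sum>i<n-N. 1 / W (hist (Suc (i + N)) \<omega>))"
    proof (rule sum_mono)
      fix i assume "i \<in> {..<n-N}"
      then have "W (hist (Suc (i + N)) \<omega>) \<le> W (hist n \<omega>)" by (intro W_hist_mono) auto
      moreover have "0 < W (hist (Suc (i + N)) \<omega>)" by (intro W_pos) (auto simp: hist_def)
      ultimately show "1 / W (hist n \<omega>) \<le> 1 / W (hist (Suc (i + N)) \<omega>)"
        using Wn by (intro divide_left_mono mult_pos_pos) auto
    qed
    also have "\<dots> \<le> (\<Sum>i. 1 / W (hist (Suc (i + N)) \<omega>))"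
      using W_nonneg by (intro sum_le_suminf[OF sm']) auto
    also have "\<dots> < 1 / (2 * D)" using N[of N] by simp
    finally have "real (n - N) * (2 * D) < W (hist n \<omega>)"
      using Wn D by (simp add: field_simps)
    moreover have "real n \<le> 2 * real (n - N)" using n by simp
    then have "D * real n \<le> real (n - N) * (2 * D)" using D by (simp add: mult.commute mult_left_mono)
    moreover have "C * real n \<le> D * real n" using D by (simp add: mult_right_mono)
    ultimately show ?thesis by linarith
  qed
  then show ?thesis by blast
qed

end

locale faq_urn_linear = faq_urn M B S p F q
  for M :: "'a measure" and B :: "nat \<Rightarrow> 'a \<Rightarrow> bool" and S :: "nat \<Rightarrow> 'a \<Rightarrow> nat" and p F q +
  fixes a :: real
  assumes a_pos: "0 < a" and lin: "\<And>j. 1 \<le> j \<Longrightarrow> a * real j \<le> wt j"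
begin

text \<open>The square root balances two demands: the squares of \<open>chase_rate m / wt j\<close>
  over j at least m must have a bounded sum, for \<open>shrink_growth\<close>, and
  \<open>growth (chase_rate m) m\<close> must grow fast enough to make \<open>start_value\<close>
  summable.\<close>

definition chase_rate :: "nat \<Rightarrow> real" where "chase_rate m = a * sqrt (real m) / 2"

text \<open>Value of \<open>chase\<close> at the birth of a colour whose boss has count m. The
  numerator 2 makes up for the 1/2 lost in \<open>shrink_growth\<close>.\<close>

definition start_value :: "nat \<Rightarrow> real" where "start_value m = 2 / growth (chase_rate m) m"

definition shrink :: "nat \<Rightarrow> nat \<Rightarrow> real" where
  "shrink m0 m = (\<Prod>j\<in>{m0..<m}. 1 - chase_rate m0 / wt j)"

text \<open>
  As a function of the counts \<open>k\<close> of a colour and \<open>m\<close> of its boss this is harmonic for the urn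
  restricted to the two colours. It is normalised so that it is at least 1 once \<open>m \<le> k\<close>.
\<close>

definition chase :: "nat \<Rightarrow> nat \<Rightarrow> nat \<Rightarrow> real" where
  "chase m0 k m = start_value m0 * growth (chase_rate m0) k * shrink m0 m"

lemma chase_rate_nonneg: "0 \<le> chase_rate m"
  using a_pos by (simp add: chase_rate_def)

lemma chase_rate_mono: "i \<le> j \<Longrightarrow> chase_rate i \<le> chase_rate j"
  using a_pos by (simp add: chase_rate_def divide_right_mono mult_left_mono)

lemma start_value_pos: "0 < start_value m"
  using growth_pos[OF chase_rate_nonneg] by (simp add: start_value_def)

lemma start_value_antimono: "i \<le> j \<Longrightarrow> start_value j \<le> start_value i"
proof -
  assume ij: "i \<le> j"
  have "growth (chase_rate i) i \<le> growth (chase_rate i) j" by (rule growth_mono[OF chase_rate_nonneg ij])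
  also have "\<dots> \<le> growth (chase_rate j) j" by (rule growth_mono_rate[OF chase_rate_nonneg chase_rate_mono[OF ij]])
  finally show ?thesis unfolding start_value_def
    using growth_pos[OF chase_rate_nonneg] by (intro divide_left_mono mult_pos_pos) auto
qed

text \<open>Keeps the factors of \<open>shrink\<close> positive: the rate is at most
  \<open>a * m0 / 2\<close>, whereas \<open>wt j\<close> is at least \<open>a * j\<close>.\<close>

lemma chase_rate_le_half_wt:
  assumes "1 \<le> m0" "m0 \<le> j"
  shows "chase_rate m0 / wt j \<le> 1 / 2"
proof -
  have "sqrt (real m0) \<le> real m0" using assms(1) real_sqrt_le_iff[of "real m0" "real m0 ^ 2"]
    by (simp add: power2_eq_square)
  then have "chase_rate m0 \<le> a * real j / 2"
    unfolding chase_rate_def using assms a_pos by (intro divide_right_mono mult_left_mono) auto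
  also have "\<dots> \<le> wt j / 2" using lin[of j] assms by simp
  finally show ?thesis using wt_pos[of j] assms by (simp add: field_simps)
qed

lemma shrink_pos: "1 \<le> m0 \<Longrightarrow> 0 < shrink m0 m"
  unfolding shrink_def
proof (intro prod_pos)
  fix j assume "1 \<le> m0" "j \<in> {m0..<m}"
  then have "chase_rate m0 / wt j \<le> 1 / 2" by (intro chase_rate_le_half_wt) auto
  then show "0 < 1 - chase_rate m0 / wt j" by linarith
qed

text \<open>Paired factors give \<open>(1 - x) * (1 + x) = 1 - x ^ 2\<close> with
  \<open>x ^ 2 \<le> m0 / (4 * j ^ 2)\<close>, so the two products are inverse to each other up to a
  constant.\<close>

lemma shrink_growth:
  assumes m0: "1 \<le> m0" "m0 \<le> m"
  shows "growth (chase_rate m0) m0 / 2 \<le> shrink m0 m * growth (chase_rate m0) m"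
proof -
  have g0: "0 < growth (chase_rate m0) m0" by (rule growth_pos[OF chase_rate_nonneg])
  \<comment> \<open>Strengthened for the induction: the bracket starts at 1, stays above 1/2, and
    falls in each step by at least \<open>m0 / (4 * m ^ 2)\<close>.\<close>
  have "growth (chase_rate m0) m0 * (1 / 2 + real m0 / (2 * real m)) \<le> shrink m0 m * growth (chase_rate m0) m"
    using m0(2)
  proof (induction m rule: dec_induct)
    case base
    then show ?case using m0 by (simp add: shrink_def)
  next
    case (step m)
    define x where "x = chase_rate m0 / wt m"
    have m1: "1 \<le> m" using step m0 by simp
    have x2: "x ^ 2 \<le> real m0 / (4 * real m ^ 2)"
    proof -
      have "0 < a * real m" using a_pos m1 by simp
      then have "x \<le> chase_rate m0 / (a * real m)"
        unfolding x_def using lin[OF m1] chase_rate_nonneg wt_pos[OF m1] a_pos m1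
        by (intro divide_left_mono mult_pos_pos) auto
      also have "\<dots> = sqrt (real m0) / (2 * real m)" using a_pos by (simp add: chase_rate_def)
      finally have "x ^ 2 \<le> (sqrt (real m0) / (2 * real m)) ^ 2"
        using chase_rate_nonneg wt_pos[OF m1] by (intro power_mono) (auto simp: x_def)
      also have "\<dots> = real m0 / (4 * real m ^ 2)" by (simp add: power_divide power_mult_distrib)
      finally show ?thesis .
    qed
    let ?A = "1 / 2 + real m0 / (2 * real m)"
    have A1: "?A \<le> 1" using step(1) m1 by (simp add: field_simps)
    have A0: "0 \<le> ?A" by simp
    have "1 / 2 + real m0 / (2 * real (Suc m)) \<le> ?A - real m0 / (4 * real m ^ 2)"
    proof -
      have "real m0 / (2 * real m) - real m0 / (2 * real (Suc m)) = real m0 / (2 * real m * real (Suc m))"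
        using m1 by (simp add: field_simps)
      moreover have "real m0 / (4 * real m ^ 2) \<le> real m0 / (2 * real m * real (Suc m))"
        using m1 by (intro divide_left_mono) (auto simp: power2_eq_square)
      ultimately show ?thesis by linarith
    qed
    also have "\<dots> \<le> ?A - x ^ 2" using x2 by simp
    also have "\<dots> \<le> ?A * (1 - x ^ 2)"
    proof -
      have "?A * x ^ 2 \<le> 1 * x ^ 2" by (rule mult_right_mono[OF A1]) simp
      then show ?thesis unfolding right_diff_distrib by simp
    qed
    finally have "growth (chase_rate m0) m0 * (1 / 2 + real m0 / (2 * real (Suc m)))
       \<le> growth (chase_rate m0) m0 * (?A * (1 - x ^ 2))"
      using g0 by (intro mult_left_mono) auto
    also have "\<dots> = (growth (chase_rate m0) m0 * ?A) * (1 - x ^ 2)" by simp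
    also have "\<dots> \<le> (shrink m0 m * growth (chase_rate m0) m) * (1 - x ^ 2)"
    proof (rule mult_right_mono[OF step.IH])
      have "x \<le> 1 / 2" "0 \<le> x"
        unfolding x_def using chase_rate_le_half_wt[OF m0(1) step(1)] chase_rate_nonneg wt_pos[OF m1] by auto
      then have "x ^ 2 \<le> (1 / 2) ^ 2" by (intro power_mono)
      then show "0 \<le> 1 - x ^ 2" by (simp add: power2_eq_square)
    qed
    also have "\<dots> = shrink m0 (Suc m) * growth (chase_rate m0) (Suc m)"
    proof -
      have s1: "shrink m0 (Suc m) = shrink m0 m * (1 - x)"
        unfolding shrink_def x_def using step(1) by (simp add: atLeastLessThanSuc)
      have s2: "growth (chase_rate m0) (Suc m) = growth (chase_rate m0) m * (1 + x)"
        unfolding x_def by (rule growth_Suc[OF m1])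
      show ?thesis unfolding s1 s2 by (simp add: power2_eq_square algebra_simps)
    qed
    finally show ?case .
  qed
  moreover have "growth (chase_rate m0) m0 * (1 / 2) \<le> growth (chase_rate m0) m0 * (1 / 2 + real m0 / (2 * real m))"
    using g0 by (intro mult_left_mono) auto
  ultimately show ?thesis by simp
qed

lemma chase_ge_ratio:
  assumes m0: "1 \<le> m0" "m0 \<le> m"
  shows "growth (chase_rate m0) k / growth (chase_rate m0) m \<le> chase m0 k m"
proof -
  have g: "0 < growth (chase_rate m0) i" for i by (rule growth_pos[OF chase_rate_nonneg])
  have "growth (chase_rate m0) k / growth (chase_rate m0) m
      = start_value m0 * growth (chase_rate m0) k * (growth (chase_rate m0) m0 / 2 / growth (chase_rate m0) m)"
    unfolding start_value_def using g[of m0] by simp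
  also have "\<dots> \<le> start_value m0 * growth (chase_rate m0) k * shrink m0 m"
    using shrink_growth[OF m0] g start_value_pos[of m0]
    by (intro mult_left_mono) (auto simp: divide_le_eq less_imp_le)
  finally show ?thesis unfolding chase_def .
qed

lemma chase_ge_1: "1 \<le> m0 \<Longrightarrow> m0 \<le> m \<Longrightarrow> m \<le> k \<Longrightarrow> 1 \<le> chase m0 k m"
  using chase_ge_ratio[of m0 m k] growth_mono[OF chase_rate_nonneg, of m k m0] growth_pos[OF chase_rate_nonneg, of m0 m]
  by (simp add: le_divide_eq order_trans[rotated])

lemma chase_nonneg: "1 \<le> m0 \<Longrightarrow> 0 \<le> chase m0 k m"
  unfolding chase_def using start_value_pos[of m0] growth_pos[OF chase_rate_nonneg, of m0 k] shrink_pos[of m0 m]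
  by (simp add: less_imp_le)

lemma chase_Suc_left: "1 \<le> k \<Longrightarrow> chase m0 (Suc k) m = chase m0 k m * (1 + chase_rate m0 / wt k)"
  unfolding chase_def by (simp add: growth_Suc)

lemma chase_Suc_right: "m0 \<le> m \<Longrightarrow> chase m0 k (Suc m) = chase m0 k m * (1 - chase_rate m0 / wt m)"
  unfolding chase_def shrink_def by (simp add: atLeastLessThanSuc)

lemma chase_start: "chase m 1 m = start_value m"
  unfolding chase_def shrink_def by simp

text \<open>Lets every colour with a large count pay for births. Here n is the count of the leader,
  k that of the colour and m that of its boss: a newborn facing n is worth at most what a draw at k
  releases, even after scaling by the colour's own chance of catching its boss.\<close>

lemma start_value_le_chase:
  assumes m0: "1 \<le> m0" "m0 \<le> m" "m \<le> n" and k: "1 \<le> k" "k \<le> n"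
  shows "start_value n \<le> start_value k * min 1 (chase m0 (Suc k) m)"
proof (cases "m \<le> Suc k")
  case True
  then have "min 1 (chase m0 (Suc k) m) = 1" using chase_ge_1[OF m0(1,2) True] by simp
  then show ?thesis using start_value_antimono[OF k(2)] by simp
next
  case False
  then have km: "Suc k \<le> m" by simp
  have g: "0 < growth (chase_rate n) i" for i by (rule growth_pos[OF chase_rate_nonneg])
  have "growth (chase_rate n) (Suc k) / growth (chase_rate n) n \<le> growth (chase_rate m0) (Suc k) / growth (chase_rate m0) m"
    using m0 km by (intro growth_ratio_mono chase_rate_nonneg chase_rate_mono) auto
  also have "\<dots> \<le> chase m0 (Suc k) m" by (rule chase_ge_ratio[OF m0(1,2)])
  finally have 1: "growth (chase_rate n) (Suc k) / growth (chase_rate n) n \<le> chase m0 (Suc k) m" .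
  have "growth (chase_rate k) k \<le> growth (chase_rate n) k" by (rule growth_mono_rate[OF chase_rate_nonneg chase_rate_mono[OF k(2)]])
  also have "\<dots> \<le> growth (chase_rate n) (Suc k)" by (rule growth_mono[OF chase_rate_nonneg]) simp
  finally have "2 \<le> start_value k * growth (chase_rate n) (Suc k)"
    unfolding start_value_def using growth_pos[OF chase_rate_nonneg, of k k] by (simp add: field_simps)
  then have "start_value n \<le> start_value k * (growth (chase_rate n) (Suc k) / growth (chase_rate n) n)"
    unfolding start_value_def[of n] using g[of n] by (simp add: field_simps)
  also have "\<dots> \<le> start_value k * chase m0 (Suc k) m"
    using 1 start_value_pos[of k] by (intro mult_left_mono) auto
  finally show ?thesis
    using start_value_antimono[OF k(2)] by (simp add: min_def)
qed

text \<open>Four factors of the product, each at least \<open>chase_rate m / wt 4\<close> and so of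
  order sqrt m, already give a growth of order m^2.\<close>

lemma summable_start_value: "summable start_value"
proof (rule summable_comparison_test')
  define C where "C = 2 / (a / (2 * wt 4)) ^ 4"
  have w4: "0 < wt 4" by (rule wt_pos) simp
  show "summable (\<lambda>m. C * inverse (real m ^ 2))"
    by (intro summable_mult inverse_power_summable) simp
  fix m :: nat assume m: "5 \<le> m"
  have "(chase_rate m / wt 4) ^ 4 = (\<Prod>j\<in>{1..<5::nat}. chase_rate m / wt 4)" by simp
  also have "\<dots> \<le> growth (chase_rate m) 5"
    unfolding growth_def
  proof (intro prod_mono conjI)
    fix i :: nat assume i: "i \<in> {1..<5}"
    have "chase_rate m / wt 4 \<le> chase_rate m / wt i"
      using i wt_mono[of i 4] wt_pos[of i] chase_rate_nonneg w4 by (intro divide_left_mono mult_pos_pos) auto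
    then show "chase_rate m / wt 4 \<le> 1 + chase_rate m / wt i" by simp
    show "0 \<le> chase_rate m / wt 4" using chase_rate_nonneg w4 by simp
  qed
  also have "\<dots> \<le> growth (chase_rate m) m" by (rule growth_mono[OF chase_rate_nonneg m])
  finally have le: "(chase_rate m / wt 4) ^ 4 \<le> growth (chase_rate m) m" .
  have eq: "(chase_rate m / wt 4) ^ 4 = (a / (2 * wt 4)) ^ 4 * real m ^ 2"
  proof -
    have "sqrt (real m) ^ 4 = (sqrt (real m) ^ 2) ^ 2" using power_mult[of "sqrt (real m)" 2 2] by simp
    also have "\<dots> = real m ^ 2" by simp
    finally show ?thesis unfolding chase_rate_def by (simp add: power_divide power_mult_distrib)
  qed
  have pos: "0 < (a / (2 * wt 4)) ^ 4 * real m ^ 2" using a_pos w4 m by simp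
  have "start_value m \<le> 2 / ((a / (2 * wt 4)) ^ 4 * real m ^ 2)"
    unfolding start_value_def using le unfolding eq by (intro frac_le pos) auto
  also have "\<dots> = C * inverse (real m ^ 2)" unfolding C_def by (simp add: field_simps)
  finally show "norm (start_value m) \<le> C * inverse (real m ^ 2)" using start_value_pos[of m] by simp
qed

section \<open>Reserves that finance the births\<close>

definition start_tail :: "nat \<Rightarrow> real" where "start_tail k = (\<Sum>j. start_value (j + k))"

lemma start_tail_Suc: "start_tail k = start_value k + start_tail (Suc k)"
  using suminf_split_head[OF summable_ignore_initial_segment[OF summable_start_value, of k]]
  by (simp add: start_tail_def)

lemma start_tail_nonneg: "0 \<le> start_tail k"
  unfolding start_tail_def
  by (intro suminf_nonneg summable_ignore_initial_segment summable_start_value) (simp add: start_value_pos less_imp_le)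

text \<open>From this count on the tail is so small that \<open>reserve\<close> never exceeds 2, in
  spite of its factor \<open>4 / (1 - q)\<close>.\<close>

definition high_level :: nat where
  "high_level = (SOME k. 1 \<le> k \<and> start_tail k \<le> (1 - q) / 4)"

lemma high_level: "1 \<le> high_level" "start_tail high_level \<le> (1 - q) / 4"
proof -
  obtain N where "\<And>n. N \<le> n \<Longrightarrow> norm (\<Sum>i. start_value (i + n)) < (1 - q) / 4"
    using suminf_exist_split[OF _ summable_start_value, of "(1 - q) / 4"] q_lt1 by auto
  from this[of "Suc N"] have "1 \<le> Suc N \<and> start_tail (Suc N) \<le> (1 - q) / 4"
    unfolding start_tail_def by (auto intro: less_imp_le order_trans[OF abs_ge_self])
  from someI[of "\<lambda>k. 1 \<le> k \<and> start_tail k \<le> (1 - q) / 4", OF this]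
  show "1 \<le> high_level" "start_tail high_level \<le> (1 - q) / 4" unfolding high_level_def by auto
qed

text \<open>
  Weight of a colour with count \<open>k\<close> in the supermartingale: each draw of it above the threshold
  \<^const>\<open>high_level\<close> releases an amount proportional to \<^term>\<open>start_value k\<close>, which finances the births.
\<close>

definition reserve :: "nat \<Rightarrow> real" where
  "reserve k = 1 + 4 / (1 - q) * start_tail (max k high_level)"

lemma reserve_ge_1: "1 \<le> reserve k"
  unfolding reserve_def using q_lt1 start_tail_nonneg by simp

lemma reserve_Suc: "reserve k - reserve (Suc k) = (if high_level \<le> k then 4 / (1 - q) * start_value k else 0)"
  unfolding reserve_def using start_tail_Suc[of k]
  by (auto simp: max_def algebra_simps not_le diff_divide_distrib[symmetric] dest: le_antisym)

lemma reserve_antimono: "i \<le> j \<Longrightarrow> reserve j \<le> reserve i"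
proof (rule lift_Suc_antimono_le[of reserve])
  fix n
  have "0 \<le> reserve n - reserve (Suc n)" unfolding reserve_Suc using start_value_pos[of n] q_lt1 by (simp add: less_imp_le)
  then show "reserve (Suc n) \<le> reserve n" by simp
qed

lemma reserve_le_2: "reserve k \<le> 2"
proof -
  have "reserve k \<le> reserve 0" by (rule reserve_antimono) simp
  also have "reserve 0 = 1 + 4 / (1 - q) * start_tail high_level" by (simp add: reserve_def)
  also have "\<dots> \<le> 1 + 4 / (1 - q) * ((1 - q) / 4)"
    using high_level(2) q_lt1 by (intro add_left_mono mult_left_mono) auto
  also have "\<dots> = 2" using q_lt1 by simp
  finally show ?thesis .
qed

end

section \<open>The potential\<close>

text \<open>Once c is present this prefix no longer changes when the history is extended, so the
  boss computed from it is fixed at birth.\<close>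

definition before :: "nat list \<Rightarrow> nat \<Rightarrow> nat list" where
  "before h c = takeWhile (\<lambda>x. x \<noteq> c) h"

definition leader :: "nat list \<Rightarrow> nat" where
  "leader h = (SOME b. b \<in> set h \<and> (\<forall>x. hist_count h x \<le> hist_count h b))"

definition boss :: "nat list \<Rightarrow> nat \<Rightarrow> nat" where
  "boss h c = leader (before h c)"

definition boss_start :: "nat list \<Rightarrow> nat \<Rightarrow> nat" where
  "boss_start h c = hist_count (before h c) (boss h c)"

lemma leader:
  assumes "h \<noteq> []"
  shows "leader h \<in> set h" "hist_count h x \<le> hist_count h (leader h)"
proof -
  let ?m = "Max (hist_count h ` set h)"
  have "?m \<in> hist_count h ` set h" using assms by (intro Max_in) auto
  then obtain b where b: "b \<in> set h" "hist_count h b = ?m" by auto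
  have "hist_count h x \<le> hist_count h b" for x
  proof (cases "x \<in> set h")
    case True
    then show ?thesis unfolding b(2) by (intro Max_ge) auto
  next
    case False
    then show ?thesis using hist_count_eq_0_iff[of h x] by simp
  qed
  then have "b \<in> set h \<and> (\<forall>x. hist_count h x \<le> hist_count h b)" using b by blast
  from someI[of "\<lambda>b. b \<in> set h \<and> (\<forall>x. hist_count h x \<le> hist_count h b)", OF this]
  show "leader h \<in> set h" "hist_count h x \<le> hist_count h (leader h)"
    unfolding leader_def by auto
qed

lemma before_snoc_old: "c \<in> set h \<Longrightarrow> before (h @ [x]) c = before h c"
  unfolding before_def by simp

lemma before_snoc_new: "c \<notin> set h \<Longrightarrow> before (h @ [c]) c = h"
  unfolding before_def by (subst takeWhile_append2) auto

lemma before_eq_take: "before h c = take (length (before h c)) h"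
  unfolding before_def by (rule takeWhile_eq_take)

lemma length_before_le: "length (before h c) \<le> length h"
  unfolding before_def by (rule length_takeWhile_le)

lemma notin_before: "c \<notin> set (before h c)"
  unfolding before_def by (auto dest: set_takeWhileD)

lemma boss_facts:
  assumes "before h c \<noteq> []"
  shows "boss h c \<in> set (before h c)" "boss h c \<in> set h" "boss h c \<noteq> c"
    "1 \<le> boss_start h c" "boss_start h c \<le> hist_count h (boss h c)"
proof -
  show 1: "boss h c \<in> set (before h c)" unfolding boss_def by (rule leader(1)[OF assms])
  then show "boss h c \<in> set h" unfolding before_def by (auto dest: set_takeWhileD)
  show "boss h c \<noteq> c" using 1 notin_before[of c h] by metis
  show "1 \<le> boss_start h c" unfolding boss_start_def using 1 hist_count_pos_iff by (simp add: Suc_le_eq)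
  have "hist_count (take n g) x \<le> hist_count g x" for n g x
  proof -
    have "hist_count (take n g @ drop n g) x = hist_count (take n g) x + hist_count (drop n g) x"
      unfolding hist_count_def filter_append length_append ..
    then show ?thesis by simp
  qed
  then show "boss_start h c \<le> hist_count h (boss h c)"
    unfolding boss_start_def by (subst before_eq_take) blast
qed

lemma boss_snoc_old:
  "c \<in> set h \<Longrightarrow> boss (h @ [x]) c = boss h c" "c \<in> set h \<Longrightarrow> boss_start (h @ [x]) c = boss_start h c"
  by (simp_all add: boss_def boss_start_def before_snoc_old)

context faq_urn_linear
begin

text \<open>Colours with fewer than n0 entries before them get the constant 1; for positive n0 this
  covers the first colour, which has no boss. The cap bounds the summand, while a colour that ends
  level with its boss or ahead still counts fully.\<close>

definition rival :: "nat \<Rightarrow> nat list \<Rightarrow> nat \<Rightarrow> real" where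
  "rival n0 h c = (if length (before h c) < n0 then 1
     else min 1 (chase (boss_start h c) (hist_count h c) (hist_count h (boss h c))))"

definition potential :: "nat \<Rightarrow> nat list \<Rightarrow> real" where
  "potential n0 h = (\<Sum>c\<in>set h. reserve (hist_count h c) * rival n0 h c)"

lemma rival_bounds:
  assumes "1 \<le> n0"
  shows "0 \<le> rival n0 h c" "rival n0 h c \<le> 1"
proof -
  show "rival n0 h c \<le> 1" by (simp add: rival_def)
  show "0 \<le> rival n0 h c"
  proof (cases "length (before h c) < n0")
    case False
    then have "before h c \<noteq> []" using assms by auto
    from boss_facts(4)[OF this] show ?thesis using False chase_nonneg by (simp add: rival_def)
  qed (simp add: rival_def)
qed

lemma potential_nonneg: "1 \<le> n0 \<Longrightarrow> 0 \<le> potential n0 h"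
  unfolding potential_def using rival_bounds(1) reserve_ge_1
  by (intro sum_nonneg mult_nonneg_nonneg) (auto intro: order_trans[OF zero_le_one])

lemma potential_le:
  assumes h: "h \<in> hists n" and n0: "1 \<le> n0"
  shows "potential n0 h \<le> 2 * real n"
proof -
  have "potential n0 h \<le> (\<Sum>c\<in>set h. 2 * 1)"
    unfolding potential_def using rival_bounds[OF n0] reserve_le_2 reserve_ge_1
    by (intro sum_mono mult_mono) (auto intro: order_trans[OF zero_le_one])
  also have "\<dots> \<le> 2 * real n" using card_set_hists_le[OF h] by simp
  finally show ?thesis .
qed

text \<open>The drifts of \<open>chase\<close> in its two counts are \<open>chase_rate m0\<close>
  times its value with opposite signs, so they cancel. The minimum of a harmonic function and a
  constant is superharmonic.\<close>

lemma min_chase_superharmonic: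
  assumes m0: "1 \<le> m0" "m0 \<le> m" and k: "1 \<le> k"
  shows "wt k * (min 1 (chase m0 (Suc k) m) - min 1 (chase m0 k m))
     + wt m * (min 1 (chase m0 k (Suc m)) - min 1 (chase m0 k m)) \<le> 0"
proof -
  let ?x = "chase m0 k m" and ?y = "chase m0 (Suc k) m" and ?z = "chase m0 k (Suc m)"
  have w: "0 < wt k" "0 < wt m" using wt_pos m0 k by auto
  have y: "wt k * ?y = wt k * ?x + chase_rate m0 * ?x" using w by (simp add: chase_Suc_left[OF k] field_simps)
  have z: "wt m * ?z = wt m * ?x - chase_rate m0 * ?x" using w by (simp add: chase_Suc_right[OF m0(2)] field_simps)
  show ?thesis
  proof (cases "?x \<le> 1")
    case True
    have "wt k * min 1 ?y \<le> wt k * ?y" "wt m * min 1 ?z \<le> wt m * ?z" using w by simp_all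
    then show ?thesis using y z True by (simp add: min_def algebra_simps split: if_splits)
  next
    case False
    then have x1: "min 1 ?x = 1" by simp
    have "wt k * (min 1 ?y - 1) \<le> 0" "wt m * (min 1 ?z - 1) \<le> 0"
      using w by (auto simp: mult_le_0_iff)
    then show ?thesis unfolding x1 by linarith
  qed
qed

text \<open>Among draws only those of c and of its boss change the summand of c. The pursuit part
  has no positive drift, and the reserve released by c leaves a loss expressed by the count of the
  leader, uniformly in c.\<close>

lemma colour_drift:
  assumes h: "h \<in> hists n" and n0: "1 \<le> n0" and c: "c \<in> set h"
  shows "(\<Sum>x\<in>set h. wt (hist_count h x) *
      (reserve (hist_count (h @ [x]) c) * rival n0 (h @ [x]) c - reserve (hist_count h c) * rival n0 h c))
    \<le> - (if high_level \<le> hist_count h c then wt (hist_count h c) * (4 / (1 - q) * start_value (hist_count h (leader h))) else 0)"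
proof -
  let ?k = "hist_count h c" and ?n = "hist_count h (leader h)"
  have ne: "h \<noteq> []" using c by auto
  have k: "1 \<le> ?k" "?k \<le> ?n" using c hist_count_pos_iff[of h c] leader(2)[OF ne] by (auto simp: Suc_le_eq)
  have wk: "0 < wt ?k" by (rule wt_pos[OF k(1)])
  have start_value_k: "start_value ?n \<le> start_value ?k" by (rule start_value_antimono[OF k(2)])
  \<comment> \<open>g is the rival value after a draw of c: 1 for an early colour, the capped
    \<open>chase\<close> at \<open>Suc k\<close> for the others.\<close>
  have drop: "wt ?k * (g * (reserve ?k - reserve (Suc ?k))) \<ge>
     (if high_level \<le> ?k then wt ?k * (4 / (1 - q) * start_value ?n) else 0)"
    if g: "0 \<le> g" "start_value ?n \<le> start_value ?k * g" for g
    unfolding reserve_Suc using g wk q_lt1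
    by (auto simp: mult.commute[of g] mult.assoc intro!: mult_left_mono divide_right_mono)
  show ?thesis
  proof (cases "length (before h c) < n0")
    case True
    have "(\<Sum>x\<in>set h. wt (hist_count h x) *
      (reserve (hist_count (h @ [x]) c) * rival n0 (h @ [x]) c - reserve ?k * rival n0 h c))
      = (\<Sum>x\<in>set h. if x = c then wt ?k * (reserve (Suc ?k) - reserve ?k) else 0)"
      using True c by (intro sum.cong) (auto simp: rival_def before_snoc_old)
    also have "\<dots> = - (wt ?k * (1 * (reserve ?k - reserve (Suc ?k))))" using c by (simp add: algebra_simps)
    finally show ?thesis using drop[of 1] start_value_k by simp
  next
    case False
    then have bne: "before h c \<noteq> []" using n0 by auto
    let ?b = "boss h c" and ?s = "boss_start h c"
    let ?m = "hist_count h ?b"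
    note bf = boss_facts[OF bne]
    have mn: "?m \<le> ?n" by (rule leader(2)[OF ne])
    let ?x = "min 1 (chase ?s ?k ?m)" and ?y = "min 1 (chase ?s (Suc ?k) ?m)" and ?z = "min 1 (chase ?s ?k (Suc ?m))"
    have y0: "0 \<le> ?y" using chase_nonneg[OF bf(4)] by simp
    have riv: "rival n0 (h @ [x]) c = min 1 (chase ?s (hist_count (h @ [x]) c) (hist_count (h @ [x]) ?b))" for x
      using False c by (simp add: rival_def before_snoc_old boss_snoc_old)
    have riv0: "rival n0 h c = ?x" using False by (simp add: rival_def)
    have "(\<Sum>x\<in>set h. wt (hist_count h x) *
      (reserve (hist_count (h @ [x]) c) * rival n0 (h @ [x]) c - reserve ?k * rival n0 h c))
      = (\<Sum>x\<in>set h. (if x = c then wt ?k * (reserve (Suc ?k) * ?y - reserve ?k * ?x) else 0)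
          + (if x = ?b then wt ?m * (reserve ?k * ?z - reserve ?k * ?x) else 0))"
    proof (rule sum.cong[OF refl])
      fix x assume "x \<in> set h"
      consider "x = c" | "x = ?b" | "x \<noteq> c" "x \<noteq> ?b" by blast
      then show "wt (hist_count h x) * (reserve (hist_count (h @ [x]) c) * rival n0 (h @ [x]) c - reserve ?k * rival n0 h c)
        = (if x = c then wt ?k * (reserve (Suc ?k) * ?y - reserve ?k * ?x) else 0)
          + (if x = ?b then wt ?m * (reserve ?k * ?z - reserve ?k * ?x) else 0)"
      proof cases
        case 1
        then show ?thesis using bf(3) unfolding riv riv0 by simp
      next
        case 2
        then show ?thesis using bf(3) unfolding riv riv0 by simp
      next
        case 3
        then show ?thesis unfolding riv riv0 by simp
      qed
    qed
    also have "\<dots> = wt ?k * (reserve (Suc ?k) * ?y - reserve ?k * ?x) + wt ?m * (reserve ?k * ?z - reserve ?k * ?x)"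
      using c bf(2) by (simp add: sum.distrib)
    \<comment> \<open>Discrete product rule: the reserve is frozen at its old value while the rival
      value changes, and its release is weighted by the rival value after the draw.\<close>
    also have "\<dots> = reserve ?k * (wt ?k * (?y - ?x) + wt ?m * (?z - ?x)) - wt ?k * (?y * (reserve ?k - reserve (Suc ?k)))"
      by (simp only: algebra_simps)
    also have "\<dots> \<le> - (wt ?k * (?y * (reserve ?k - reserve (Suc ?k))))"
    proof -
      have "reserve ?k * (wt ?k * (?y - ?x) + wt ?m * (?z - ?x)) \<le> 0"
        using min_chase_superharmonic[OF bf(4,5) k(1)] reserve_ge_1[of ?k]
        by (intro mult_nonneg_nonpos) auto
      then show ?thesis by linarith
    qed
    also have "\<dots> \<le> - (if high_level \<le> ?k then wt ?k * (4 / (1 - q) * start_value ?n) else 0)"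
      using drop[OF y0 start_value_le_chase[OF bf(4,5) mn k]] by linarith
    finally show ?thesis .
  qed
qed

text \<open>A birth leaves the old counts and bosses alone. The newborn faces the leader, so its
  pursuit value is at most the start value there, times a reserve of at most 2.\<close>

lemma potential_snoc_new:
  assumes h: "h \<in> hists n" and n: "1 \<le> n0" "n0 \<le> n"
  shows "potential n0 (h @ [Suc (card (set h))]) \<le> potential n0 h + 2 * start_value (hist_count h (leader h))"
proof -
  let ?c = "Suc (card (set h))"
  have len: "length h = n" by (rule length_hists[OF h])
  have ne: "h \<noteq> []" using len n by auto
  have new: "?c \<notin> set h" by (rule new_notin_hists[OF h])
  have lead: "leader h \<in> set h" by (rule leader(1)[OF ne])
  have old: "reserve (hist_count (h @ [?c]) x) * rival n0 (h @ [?c]) x = reserve (hist_count h x) * rival n0 h x"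
    if x: "x \<in> set h" for x
  proof -
    have "x \<noteq> ?c" using x new by auto
    moreover have "boss h x \<noteq> ?c" if "\<not> length (before h x) < n0"
    proof -
      have "before h x \<noteq> []" using that n by auto
      from boss_facts(2)[OF this] new show ?thesis by auto
    qed
    ultimately show ?thesis using x by (auto simp: rival_def before_snoc_old boss_snoc_old)
  qed
  have cnt: "hist_count (h @ [?c]) ?c = 1" using new hist_count_eq_0_iff[of h ?c] by simp
  have b: "boss (h @ [?c]) ?c = leader h" "boss_start (h @ [?c]) ?c = hist_count h (leader h)"
    using new by (simp_all add: boss_def boss_start_def before_snoc_new)
  have "hist_count (h @ [?c]) (leader h) = hist_count h (leader h)" using lead new by auto
  then have "rival n0 (h @ [?c]) ?c \<le> start_value (hist_count h (leader h))"
    unfolding rival_def b cnt using new len n by (simp add: before_snoc_new chase_start[unfolded One_nat_def])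
  then have "reserve (hist_count (h @ [?c]) ?c) * rival n0 (h @ [?c]) ?c \<le> 2 * start_value (hist_count h (leader h))"
    using reserve_le_2 reserve_ge_1 rival_bounds(1)[OF n(1)] by (intro mult_mono) auto
  moreover have "potential n0 (h @ [?c]) = reserve (hist_count (h @ [?c]) ?c) * rival n0 (h @ [?c]) ?c + potential n0 h"
    unfolding potential_def using new old by simp
  ultimately show ?thesis by simp
qed

text \<open>With r the start value at the leader's count, a birth costs at most 2 r. By
  \<open>good\<close>, colours below the threshold carry at most half of the weight, so draws bring
  in at least \<open>(1 - p n) * (4 / (1 - q)) * r / 2\<close>, which is at least 2 r.\<close>

lemma potential_step:
  assumes h: "h \<in> hists n" and n: "1 \<le> n0" "n0 \<le> n" and good: "2 * wt high_level * real n \<le> W h"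
  shows "step (potential n0) h \<le> potential n0 h"
proof -
  have len: "length h = n" by (rule length_hists[OF h])
  have ne: "h \<noteq> []" using len n by auto
  have Wp: "0 < W h" by (rule W_pos[OF ne])
  let ?r = "start_value (hist_count h (leader h))"
  let ?D = "\<Sum>x\<in>set h. wt (hist_count h x) * (potential n0 (h @ [x]) - potential n0 h)"
  have "?D = (\<Sum>x\<in>set h. \<Sum>c\<in>set h. wt (hist_count h x) *
      (reserve (hist_count (h @ [x]) c) * rival n0 (h @ [x]) c - reserve (hist_count h c) * rival n0 h c))"
  proof (rule sum.cong[OF refl])
    fix x assume "x \<in> set h"
    then have "set (h @ [x]) = set h" by auto
    then have "potential n0 (h @ [x]) - potential n0 h = (\<Sum>c\<in>set h.
      reserve (hist_count (h @ [x]) c) * rival n0 (h @ [x]) c - reserve (hist_count h c) * rival n0 h c)"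
      unfolding potential_def by (simp only: sum_subtractf)
    then show "wt (hist_count h x) * (potential n0 (h @ [x]) - potential n0 h) = (\<Sum>c\<in>set h. wt (hist_count h x) *
      (reserve (hist_count (h @ [x]) c) * rival n0 (h @ [x]) c - reserve (hist_count h c) * rival n0 h c))"
      by (simp only: sum_distrib_left)
  qed
  also have "\<dots> = (\<Sum>c\<in>set h. \<Sum>x\<in>set h. wt (hist_count h x) *
      (reserve (hist_count (h @ [x]) c) * rival n0 (h @ [x]) c - reserve (hist_count h c) * rival n0 h c))"
    by (rule sum.swap)
  also have "\<dots> \<le> (\<Sum>c\<in>set h. - (if high_level \<le> hist_count h c then wt (hist_count h c) * (4 / (1 - q) * ?r) else 0))"
    by (intro sum_mono colour_drift[OF h n(1)])
  also have "\<dots> = - (4 / (1 - q) * ?r) * (\<Sum>c\<in>set h. if high_level \<le> hist_count h c then wt (hist_count h c) else 0)"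
    by (simp only: sum_distrib_left) (intro sum.cong, auto)
  also have "\<dots> \<le> - (4 / (1 - q) * ?r) * (W h / 2)"
  proof (rule mult_left_mono_neg)
    have "W h - (\<Sum>c\<in>set h. if high_level \<le> hist_count h c then wt (hist_count h c) else 0)
       = (\<Sum>c\<in>set h. if high_level \<le> hist_count h c then 0 else wt (hist_count h c))"
      unfolding W_def sum_subtractf[symmetric] by (intro sum.cong) auto
    also have "\<dots> \<le> (\<Sum>c\<in>set h. wt high_level)"
    proof (rule sum_mono)
      fix c assume "c \<in> set h"
      then have "1 \<le> hist_count h c" using hist_count_pos_iff[of h c] by simp
      then show "(if high_level \<le> hist_count h c then 0 else wt (hist_count h c)) \<le> wt high_level"
        using wt_mono[of "hist_count h c" high_level] wt_pos[OF high_level(1)] by auto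
    qed
    also have "\<dots> \<le> real n * wt high_level"
      using card_set_hists_le[OF h] wt_pos[OF high_level(1)] by (simp add: mult_right_mono)
    also have "\<dots> \<le> W h / 2" using good by (simp add: field_simps)
    finally show "W h / 2 \<le> (\<Sum>c\<in>set h. if high_level \<le> hist_count h c then wt (hist_count h c) else 0)"
      by simp
    show "- (4 / (1 - q) * ?r) \<le> 0" using start_value_pos q_lt1 by (simp add: less_imp_le)
  qed
  finally have D: "?D \<le> - (4 / (1 - q) * ?r) * (W h / 2)" .
  have "(\<Sum>c\<in>set h. (wt (hist_count h c) / W h) *\<^sub>R (potential n0 (h @ [c]) - potential n0 h)) = ?D / W h"
    by (simp add: sum_divide_distrib)
  also have "\<dots> \<le> (- (4 / (1 - q) * ?r) * (W h / 2)) / W h"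
    using Wp by (intro divide_right_mono D) auto
  also have "\<dots> = - (2 * ?r / (1 - q))" using Wp q_lt1 by (simp add: field_simps)
  finally have old: "(1 - p n) * (\<Sum>c\<in>set h. (wt (hist_count h c) / W h) *\<^sub>R (potential n0 (h @ [c]) - potential n0 h))
     \<le> (1 - p n) * (- (2 * ?r / (1 - q)))"
    using p_bounds[of n] n by (intro mult_left_mono) auto
  have "2 * ?r = (1 - q) * (2 * ?r / (1 - q))" using q_lt1 by simp
  also have "\<dots> \<le> (1 - p n) * (2 * ?r / (1 - q))"
    using p_bounds(3)[of n] n start_value_pos q_lt1 by (intro mult_right_mono) (auto simp: less_imp_le)
  finally have old': "(1 - p n) * (- (2 * ?r / (1 - q))) \<le> - (2 * ?r)" by simp
  have "p n * (potential n0 (h @ [Suc (card (set h))]) - potential n0 h) \<le> p n * (2 * ?r)"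
    using potential_snoc_new[OF h n] p_bounds[of n] n by (intro mult_left_mono) auto
  also have "\<dots> \<le> 1 * (2 * ?r)"
    using p_bounds[of n] n start_value_pos by (intro mult_right_mono) (auto simp: less_imp_le)
  finally have new: "p n * (potential n0 (h @ [Suc (card (set h))]) - potential n0 h) \<le> 2 * ?r" by simp
  have "step (potential n0) h - potential n0 h \<le> 0"
    unfolding step_diff[OF ne] len using old old' new by simp
  then show ?thesis by simp
qed

text \<open>Killed as soon as the weight bound required by \<open>potential_step\<close> fails. The
  test involves only strict prefixes, so whether the next value is killed is known before the next
  colour.\<close>

definition stopped :: "nat \<Rightarrow> nat list \<Rightarrow> real" where
  "stopped n0 h = (if \<forall>t\<in>{n0..<length h}. 2 * wt high_level * real t \<le> W (take t h) then potential n0 h else 0)"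

lemma expectation_stopped:
  assumes n: "1 \<le> n0"
  shows "(\<integral>\<omega>. stopped n0 (hist (n0 + i) \<omega>) \<partial>M) \<le> 2 * real n0"
proof (induction i)
  case 0
  have "(\<integral>\<omega>. stopped n0 (hist n0 \<omega>) \<partial>M) \<le> (\<integral>\<omega>. 2 * real n0 \<partial>M)"
    by (rule integral_hist_mono[where g="\<lambda>_. 2 * real n0"])
      (use potential_le[OF _ n] in \<open>auto simp: stopped_def length_hists\<close>)
  then show ?case by (simp add: prob_space)
next
  case (Suc i)
  have "(\<integral>\<omega>. stopped n0 (hist (Suc (n0 + i)) \<omega>) \<partial>M) = (\<integral>\<omega>. step (stopped n0) (hist (n0 + i) \<omega>) \<partial>M)"
    using n by (intro integral_hist_Suc) simp
  also have "\<dots> \<le> (\<integral>\<omega>. stopped n0 (hist (n0 + i) \<omega>) \<partial>M)"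
  proof (rule integral_hist_mono)
    fix h assume h: "h \<in> hists (n0 + i)"
    have len: "length h = n0 + i" by (rule length_hists[OF h])
    define G where "G \<longleftrightarrow> (\<forall>t\<in>{n0..<length h}. 2 * wt high_level * real t \<le> W (take t h)) \<and> 2 * wt high_level * real (n0 + i) \<le> W h"
    have snoc: "stopped n0 (h @ [x]) = (if G then potential n0 (h @ [x]) else 0)" for x
    proof -
      have "{n0..<length (h @ [x])} = insert (n0 + i) {n0..<length h}" using len by auto
      then show ?thesis unfolding stopped_def G_def using len by auto
    qed
    show "step (stopped n0) h \<le> stopped n0 h"
    proof (cases G)
      case True
      then have "step (stopped n0) h = step (potential n0) h" unfolding step_def snoc by simp
      also have "\<dots> \<le> potential n0 h" using True unfolding G_def by (intro potential_step[OF h n]) auto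
      also have "\<dots> = stopped n0 h" using True unfolding G_def stopped_def by simp
      finally show ?thesis .
    next
      case False
      then have "step (stopped n0) h = 0" unfolding step_def snoc by simp
      then show ?thesis using potential_nonneg[OF n] by (simp add: stopped_def)
    qed
  qed
  finally show ?case using Suc by simp
qed

text \<open>Fatou's lemma for expectations bounded by \<open>2 * n0\<close>. All n0 are treated at
  once because the one used later depends on the path.\<close>

lemma AE_liminf_stopped:
  "AE \<omega> in M. \<forall>n0\<ge>1. liminf (\<lambda>i. ennreal (stopped n0 (hist (n0 + i) \<omega>))) \<noteq> \<infinity>"
  unfolding AE_all_countable
proof (intro allI)
  fix n0 :: nat
  show "AE \<omega> in M. 1 \<le> n0 \<longrightarrow> liminf (\<lambda>i. ennreal (stopped n0 (hist (n0 + i) \<omega>))) \<noteq> \<infinity>"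
  proof (cases "1 \<le> n0")
    case True
    have [measurable]: "(\<lambda>\<omega>. ennreal (stopped n0 (hist n \<omega>))) \<in> borel_measurable M" for n
      by (rule measurable_compose[OF hist_meas]) simp
    have "(\<integral>\<^sup>+\<omega>. liminf (\<lambda>i. ennreal (stopped n0 (hist (n0 + i) \<omega>))) \<partial>M)
       \<le> liminf (\<lambda>i. \<integral>\<^sup>+\<omega>. ennreal (stopped n0 (hist (n0 + i) \<omega>)) \<partial>M)"
      by (rule nn_integral_liminf) simp
    also have "\<dots> = liminf (\<lambda>i. ennreal (\<integral>\<omega>. stopped n0 (hist (n0 + i) \<omega>) \<partial>M))"
      using potential_nonneg[OF True]
      by (subst nn_integral_eq_integral) (auto simp: stopped_def intro: integral_hist(1))
    also have "\<dots> \<le> liminf (\<lambda>i::nat. ennreal (2 * real n0))"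
      by (intro Liminf_mono always_eventually allI ennreal_leI expectation_stopped[OF True])
    also have "\<dots> = ennreal (2 * real n0)" by (simp add: Liminf_const)
    finally have "(\<integral>\<^sup>+\<omega>. liminf (\<lambda>i. ennreal (stopped n0 (hist (n0 + i) \<omega>))) \<partial>M) \<noteq> \<infinity>"
      by (auto simp: top_unique)
    then have "AE \<omega> in M. liminf (\<lambda>i. ennreal (stopped n0 (hist (n0 + i) \<omega>))) \<noteq> \<infinity>"
      by (intro nn_integral_PInf_AE) simp_all
    then show ?thesis by simp
  qed simp
qed

end

section \<open>Conclusion\<close>

context faq_urn_linear
begin

lemma before_hist_stable:
  assumes "c \<in> set (hist m \<omega>)" "m \<le> n"
  shows "before (hist n \<omega>) c = before (hist m \<omega>) c"
  using assms(2)
proof (induction n rule: dec_induct)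
  case (step n)
  have "set (hist m \<omega>) \<subseteq> set (hist n \<omega>)"
    using take_hist[OF step(1), of \<omega>] by (metis set_take_subset)
  then have "before (hist (Suc n) \<omega>) c = before (hist n \<omega>) c"
    unfolding hist_Suc using assms(1) by (intro before_snoc_old) blast
  then show ?case using step.IH by simp
qed simp

lemma set_hist_mono: "m \<le> n \<Longrightarrow> set (hist m \<omega>) \<subseteq> set (hist n \<omega>)"
  using take_hist[of m n \<omega>] by (metis set_take_subset)

text \<open>A finite liminf leaves only finitely many colours that end level with their boss or
  ahead. Following bosses back in time then bounds all final counts by one constant, so the weight
  grows at most linearly and its reciprocals dominate a multiple of the harmonic series.\<close>

lemma path_contradiction:
  assumes n0: "1 \<le> n0"
    and path: "\<And>n. hist n \<omega> \<in> hists n"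
    and good: "\<And>t. n0 \<le> t \<Longrightarrow> 2 * wt high_level * real t \<le> W (hist t \<omega>)"
    and fin: "liminf (\<lambda>i. ennreal (stopped n0 (hist (n0 + i) \<omega>))) \<noteq> \<infinity>"
    and bdd: "\<And>c. bounded_count c \<omega>"
    and sm: "summable (\<lambda>n. 1 / W (hist (Suc n) \<omega>))"
  shows False
proof -
  have "\<forall>c. \<exists>k. \<forall>\<^sub>F n in sequentially. hist_count (hist n \<omega>) c = k"
    using bounded_count_eventually_const[OF bdd] by metis
  \<comment> \<open>Here \<kappa> denotes the final counts and not a rate.\<close>
  then obtain \<kappa> where \<kappa>: "\<And>c. \<forall>\<^sub>F n in sequentially. hist_count (hist n \<omega>) c = \<kappa> c"
    by metis
  have le_\<kappa>: "hist_count (hist n \<omega>) c \<le> \<kappa> c" for n c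
  proof -
    from eventually_happens'[OF sequentially_bot eventually_conj[OF \<kappa>[of c] eventually_ge_at_top[of n]]]
    obtain m where "hist_count (hist m \<omega>) c = \<kappa> c" "n \<le> m" by blast
    then show ?thesis using hist_count_hist_mono[of n m \<omega> c] by simp
  qed
  have "\<exists>n. c \<in> set (hist n \<omega>)" if "0 < \<kappa> c" for c
  proof -
    from eventually_happens'[OF sequentially_bot \<kappa>[of c]]
    obtain n where "hist_count (hist n \<omega>) c = \<kappa> c" by blast
    then show ?thesis using that hist_count_pos_iff[of "hist n \<omega>" c] by auto
  qed
  then have "\<forall>c. \<exists>n. 0 < \<kappa> c \<longrightarrow> c \<in> set (hist n \<omega>)" by blast
  then obtain ap where ap: "\<And>c. 0 < \<kappa> c \<Longrightarrow> c \<in> set (hist (ap c) \<omega>)" by metis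
  define pre where "pre c = before (hist (ap c) \<omega>) c" for c
  define bo where "bo c = boss (hist (ap c) \<omega>) c" for c
  have pre: "before (hist n \<omega>) c = pre c" "boss (hist n \<omega>) c = bo c" if "0 < \<kappa> c" "ap c \<le> n" for c n
    using before_hist_stable[OF ap[OF that(1)] that(2)] by (simp_all add: pre_def bo_def boss_def)
  \<comment> \<open>The colours whose \<open>rival\<close> is eventually 1. Each of them contributes
    at least 1 to the potential once all counts involved are final.\<close>
  define T where "T = {c. 0 < \<kappa> c \<and> (length (pre c) < n0 \<or> \<kappa> (bo c) \<le> \<kappa> c)}"
  have "finite T"
  proof (rule ccontr)
    assume inf: "infinite T"
    obtain Y where Y: "liminf (\<lambda>i. ennreal (stopped n0 (hist (n0 + i) \<omega>))) = ennreal Y" "0 \<le> Y"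
      using fin by (cases "liminf (\<lambda>i. ennreal (stopped n0 (hist (n0 + i) \<omega>)))") auto
    obtain N :: nat where N: "Y < real N" using reals_Archimedean2 by blast
    obtain A where A: "A \<subseteq> T" "finite A" "card A = N"
      using infinite_arbitrarily_large[OF inf] by blast
    have "\<forall>\<^sub>F n in sequentially. \<forall>c\<in>A. hist_count (hist n \<omega>) c = \<kappa> c \<and> hist_count (hist n \<omega>) (bo c) = \<kappa> (bo c) \<and> ap c \<le> n"
      using A(2) \<kappa> by (intro eventually_ball_finite ballI eventually_conj eventually_ge_at_top) auto
    then have "\<forall>\<^sub>F n in sequentially. real N \<le> potential n0 (hist n \<omega>)"
    proof eventually_elim
      case (elim n)
      have *: "c \<in> set (hist n \<omega>) \<and> 1 \<le> reserve (hist_count (hist n \<omega>) c) * rival n0 (hist n \<omega>) c" if c: "c \<in> A" for c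
      proof -
        have cT: "0 < \<kappa> c" "length (pre c) < n0 \<or> \<kappa> (bo c) \<le> \<kappa> c" using A(1) c unfolding T_def by auto
        have e: "hist_count (hist n \<omega>) c = \<kappa> c" "hist_count (hist n \<omega>) (bo c) = \<kappa> (bo c)" "ap c \<le> n"
          using elim c by auto
        note pn = pre[OF cT(1) e(3)]
        have "rival n0 (hist n \<omega>) c = 1"
        proof (cases "length (pre c) < n0")
          case False
          then have ne: "before (hist n \<omega>) c \<noteq> []" using n0 unfolding pn by auto
          have "1 \<le> chase (boss_start (hist n \<omega>) c) (\<kappa> c) (\<kappa> (bo c))"
            using boss_facts(4,5)[OF ne] cT(2) False unfolding pn e by (intro chase_ge_1) auto
          then show ?thesis using False unfolding rival_def pn e by simp
        qed (simp add: rival_def pn)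
        moreover have "c \<in> set (hist n \<omega>)" using ap[OF cT(1)] set_hist_mono[OF e(3)] by blast
        ultimately show ?thesis using reserve_ge_1 by simp
      qed
      have "real N = (\<Sum>c\<in>A. 1)" using A(3) by simp
      also have "\<dots> \<le> (\<Sum>c\<in>A. reserve (hist_count (hist n \<omega>) c) * rival n0 (hist n \<omega>) c)"
        using * by (intro sum_mono) blast
      also have "\<dots> \<le> potential n0 (hist n \<omega>)"
        unfolding potential_def
      proof (rule sum_mono2)
        show "A \<subseteq> set (hist n \<omega>)" using * by blast
        fix c
        show "0 \<le> reserve (hist_count (hist n \<omega>) c) * rival n0 (hist n \<omega>) c"
          using reserve_ge_1[of "hist_count (hist n \<omega>) c"] rival_bounds(1)[OF n0] by (intro mult_nonneg_nonneg) auto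
      qed simp
      finally show ?case .
    qed
    then obtain n1 where n1: "\<And>n. n1 \<le> n \<Longrightarrow> real N \<le> potential n0 (hist n \<omega>)"
      unfolding eventually_sequentially by blast
    have "ennreal (real N) \<le> liminf (\<lambda>i. ennreal (stopped n0 (hist (n0 + i) \<omega>)))"
    proof (rule Liminf_bounded, rule eventually_sequentiallyI)
      fix i assume i: "n1 \<le> i"
      have "stopped n0 (hist (n0 + i) \<omega>) = potential n0 (hist (n0 + i) \<omega>)"
        unfolding stopped_def using good by (auto simp: take_hist)
      then show "ennreal (real N) \<le> ennreal (stopped n0 (hist (n0 + i) \<omega>))"
        using n1[of "n0 + i"] i by (simp add: ennreal_leI)
    qed
    then show False using N Y by simp
  qed
  \<comment> \<open>The inserted 1 makes the set nonempty and keeps L in the range where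
    \<open>wt\<close> is positive.\<close>
  define L where "L = Max (insert 1 (\<kappa> ` T))"
  have finT: "finite (insert 1 (\<kappa> ` T))" using \<open>finite T\<close> by simp
  \<comment> \<open>Strong induction on the time of birth: a colour outside T with positive final
    count ends below its boss, which was born earlier.\<close>
  have bound: "\<kappa> c \<le> L" for c
  proof (induction "length (pre c)" arbitrary: c rule: less_induct)
    case less
    consider "\<kappa> c = 0" | "c \<in> T" | "0 < \<kappa> c" "n0 \<le> length (pre c)" "\<kappa> c < \<kappa> (bo c)"
      unfolding T_def by force
    then show ?case
    proof cases
      case 2
      then show ?thesis unfolding L_def by (intro Max_ge[OF finT]) simp
    next
      case 3
      have ne: "before (hist (ap c) \<omega>) c \<noteq> []" using 3(2) n0 unfolding pre_def by auto
      have b: "bo c \<in> set (before (hist (ap c) \<omega>) c)"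
        using boss_facts(1)[OF ne] unfolding bo_def .
      let ?t = "length (pre c)"
      have "?t \<le> ap c" unfolding pre_def using length_before_le[of "hist (ap c) \<omega>" c] by simp
      then have pre_hist: "pre c = hist ?t \<omega>"
        using before_eq_take[of "hist (ap c) \<omega>" c] take_hist[of ?t "ap c" \<omega>] unfolding pre_def by simp
      have bt: "bo c \<in> set (hist ?t \<omega>)" using b pre_hist unfolding pre_def by simp
      have kb: "0 < \<kappa> (bo c)" using 3 by simp
      have "pre (bo c) = before (hist (max ?t (ap (bo c))) \<omega>) (bo c)"
        using pre(1)[OF kb, of "max ?t (ap (bo c))"] by simp
      also have "\<dots> = before (hist ?t \<omega>) (bo c)"
        by (rule before_hist_stable[OF bt]) simp
      finally have pb: "pre (bo c) = before (hist ?t \<omega>) (bo c)" .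
      have "length (pre (bo c)) < ?t"
      proof -
        have "length (pre (bo c)) \<noteq> ?t"
        proof
          assume "length (pre (bo c)) = ?t"
          then have "before (hist ?t \<omega>) (bo c) = hist ?t \<omega>"
            using before_eq_take[of "hist ?t \<omega>" "bo c"] pb by simp
          then show False using notin_before[of "bo c" "hist ?t \<omega>"] bt by simp
        qed
        moreover have "length (pre (bo c)) \<le> ?t"
          unfolding pb using length_before_le[of "hist ?t \<omega>" "bo c"] by simp
        ultimately show ?thesis by simp
      qed
      from less[OF this] show ?thesis using 3 by simp
    qed simp
  qed
  have L1: "1 \<le> L" unfolding L_def by (rule Max_ge[OF finT]) simp
  have Wle: "W (hist (Suc n) \<omega>) \<le> real (Suc n) * wt L" for n
    using le_\<kappa> bound order_trans by (intro weight_le_if_counts_less path) blast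
  have "summable (\<lambda>n. 1 / (real (Suc n) * wt L))"
  proof (rule summable_comparison_test'[OF sm])
    fix n :: nat assume "0 \<le> n"
    have "0 < W (hist (Suc n) \<omega>)" by (intro W_pos) (simp add: hist_def)
    moreover have "0 < real (Suc n) * wt L" using wt_pos[OF L1] by simp
    ultimately show "norm (1 / (real (Suc n) * wt L)) \<le> 1 / W (hist (Suc n) \<omega>)"
      using Wle[of n] by (simp add: frac_le)
  qed
  then have "summable (\<lambda>n. wt L * (1 / (real (Suc n) * wt L)))" by (rule summable_mult)
  moreover have "wt L * (1 / (real (Suc n) * wt L)) = inverse (real (Suc n))" for n
    using wt_pos[OF L1] by (simp add: inverse_eq_divide)
  ultimately have "summable (\<lambda>n. inverse (real (Suc n)))" by (simp only:)
  then show False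
    using not_summable_harmonic[where 'a=real] summable_Suc_iff[of "\<lambda>n. inverse (real n)"] by simp
qed

lemma AE_some_unbounded:
  "AE \<omega> in M. summable (\<lambda>n. 1 / W (hist (Suc n) \<omega>)) \<longrightarrow> (\<exists>c. \<not> bounded_count c \<omega>)"
  using AE_hist_in AE_liminf_stopped
proof eventually_elim
  case (elim \<omega>)
  show ?case
  proof (intro impI, rule ccontr)
    assume sm: "summable (\<lambda>n. 1 / W (hist (Suc n) \<omega>))" and "\<not> (\<exists>c. \<not> bounded_count c \<omega>)"
    then have bdd: "bounded_count c \<omega>" for c by blast
    obtain N where N: "\<forall>n\<ge>N. 2 * wt high_level * real n \<le> W (hist n \<omega>)"
      using W_superlinear[OF sm] by blast
    have "2 * wt high_level * real t \<le> W (hist t \<omega>)" if "max 1 N \<le> t" for t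
      using N that by simp
    moreover have "liminf (\<lambda>i. ennreal (stopped (max 1 N) (hist (max 1 N + i) \<omega>))) \<noteq> \<infinity>"
      using elim(2) by simp
    ultimately show False
      using path_contradiction[of "max 1 N" \<omega>] elim(1) bdd sm by simp
  qed
qed

end

context faq_urn
begin

section \<open>Back to the quantities of the urn, and the two cases\<close>

lemma urn_K_eq_hist_count: "urn_K S n c \<omega> = hist_count (hist n \<omega>) c"
proof (induction n)
  case (Suc n)
  have "{i\<in>{1..Suc n}. S i \<omega> = c} = {i\<in>{1..n}. S i \<omega> = c} \<union> (if S (Suc n) \<omega> = c then {Suc n} else {})"
    by (auto simp: le_Suc_eq)
  then show ?case using Suc unfolding urn_K_def by (simp add: hist_Suc)
qed (simp add: urn_K_def)

lemma infinite_occurrences_iff: "infinite {n. n \<ge> 1 \<and> S n \<omega> = c} \<longleftrightarrow> \<not> bounded_count c \<omega>"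
proof
  assume inf: "infinite {n. n \<ge> 1 \<and> S n \<omega> = c}"
  show "\<not> bounded_count c \<omega>"
  proof
    assume "bounded_count c \<omega>"
    then obtain k where k: "\<And>n. hist_count (hist n \<omega>) c < k" unfolding bounded_count_def by blast
    obtain A where A: "A \<subseteq> {n. n \<ge> 1 \<and> S n \<omega> = c}" "finite A" "card A = k"
      using infinite_arbitrarily_large[OF inf] by blast
    have "A \<subseteq> {i\<in>{1..Max (insert 0 A)}. S i \<omega> = c}"
      using A(1,2) by (auto intro!: Max_ge)
    then have "card A \<le> urn_K S (Max (insert 0 A)) c \<omega>"
      unfolding urn_K_def by (intro card_mono) auto
    then show False using k[of "Max (insert 0 A)"] A(3) unfolding urn_K_eq_hist_count by simp
  qed
next
  assume nb: "\<not> bounded_count c \<omega>"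
  show "infinite {n. n \<ge> 1 \<and> S n \<omega> = c}"
  proof
    assume fin: "finite {n. n \<ge> 1 \<and> S n \<omega> = c}"
    have "hist_count (hist n \<omega>) c < Suc (card {n. n \<ge> 1 \<and> S n \<omega> = c})" for n
      unfolding urn_K_eq_hist_count[symmetric] urn_K_def less_Suc_eq_le
      by (intro card_mono[OF fin]) auto
    then show False using nb unfolding bounded_count_def by blast
  qed
qed

lemma AE_urn_C: "AE \<omega> in M. \<forall>n. urn_C B n \<omega> = card (set (hist n \<omega>))"
  using AE_hist
proof eventually_elim
  case (elim \<omega>)
  have "urn_C B n \<omega> = card (set (hist n \<omega>))" for n
  proof (induction n)
    case (Suc n)
    have "{i\<in>{0..<Suc n}. B i \<omega>} = {i\<in>{0..<n}. B i \<omega>} \<union> (if B n \<omega> then {n} else {})"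
      by (auto simp: less_Suc_eq)
    then have "urn_C B (Suc n) \<omega> = urn_C B n \<omega> + (if B n \<omega> then 1 else 0)"
      unfolding urn_C_def by simp
    also have "\<dots> = card (set (hist (Suc n) \<omega>))"
      using Suc elim by (auto simp: hist_Suc insert_absorb)
    finally show ?case .
  qed (simp add: urn_C_def)
  then show ?case by blast
qed

lemma linear_growth_imp_some_unbounded:
  assumes "0 < a" "\<And>j. 1 \<le> j \<Longrightarrow> a * real j \<le> wt j"
  shows "AE \<omega> in M. summable (\<lambda>n. 1 / W (hist (Suc n) \<omega>)) \<longrightarrow> (\<exists>c. \<not> bounded_count c \<omega>)"
proof -
  interpret faq_urn_linear M B S p F q a
    using assms by unfold_locales
  show ?thesis by (rule AE_some_unbounded)
qed

text \<open>The terms decrease, so \<open>j / wt j\<close> is at most the sum of the first j terms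
  and hence at most the whole series.\<close>

lemma summable_imp_linear_growth:
  assumes sm: "summable (\<lambda>k. 1 / wt (Suc k))"
  shows "\<exists>a>0. \<forall>j\<ge>1. a * real j \<le> wt j"
proof -
  define T where "T = (\<Sum>k. 1 / wt (Suc k))"
  have T: "0 < T" unfolding T_def using wt_pos by (intro suminf_pos[OF sm]) auto
  have "1 / T * real j \<le> wt j" if j: "1 \<le> j" for j
  proof -
    have "real j * (1 / wt j) = (\<Sum>k<j. 1 / wt j)" by simp
    also have "\<dots> \<le> (\<Sum>k<j. 1 / wt (Suc k))"
      using wt_mono wt_pos by (intro sum_mono frac_le) auto
    also have "\<dots> \<le> T"
      unfolding T_def using wt_pos by (intro sum_le_suminf[OF sm]) (auto intro: less_imp_le)
    finally show ?thesis using T wt_pos[OF j] by (simp add: field_simps)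
  qed
  then show ?thesis using T by (intro exI[of _ "1 / T"]) auto
qed

lemma AE_unique_unbounded:
  assumes sm: "summable (\<lambda>k. 1 / wt (Suc k))"
  shows "AE \<omega> in M. \<exists>c. \<not> bounded_count c \<omega> \<and> (\<forall>c'. c' \<noteq> c \<longrightarrow> bounded_count c' \<omega>)"
proof -
  obtain a where a: "0 < a" "\<And>j. 1 \<le> j \<Longrightarrow> a * real j \<le> wt j"
    using summable_imp_linear_growth[OF sm] by blast
  have "AE \<omega> in M. summable (\<lambda>n. 1 / W (hist (Suc n) \<omega>)) \<longrightarrow> (\<exists>c. \<not> bounded_count c \<omega>)"
    by (rule linear_growth_imp_some_unbounded[OF a(1)]) (rule a(2))
  then show ?thesis
    using AE_summable_inverse_W[OF sm] AE_at_most_one_unbounded[OF sm]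
    by eventually_elim blast
qed

text \<open>With a linear lower bound a convergent clock would produce an unbounded count, against
  \<open>AE_counts_bounded\<close>. Without one, every positive slope is undercut at some j, which
  is the sublinear case.\<close>

lemma AE_not_summable_inverse_W:
  assumes ns: "\<not> summable (\<lambda>k. 1 / wt (Suc k))"
  shows "AE \<omega> in M. \<not> summable (\<lambda>n. 1 / W (hist (Suc n) \<omega>))"
proof (cases "\<exists>a>0. \<forall>j\<ge>1. a * real j \<le> wt j")
  case True
  then obtain a where a: "0 < a" "\<And>j. 1 \<le> j \<Longrightarrow> a * real j \<le> wt j" by blast
  have "AE \<omega> in M. summable (\<lambda>n. 1 / W (hist (Suc n) \<omega>)) \<longrightarrow> (\<exists>c. \<not> bounded_count c \<omega>)"
    by (rule linear_growth_imp_some_unbounded[OF a(1)]) (rule a(2))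
  then show ?thesis
    using AE_counts_bounded[OF ns]
    by eventually_elim (auto simp: bounded_count_def)
next
  case False
  then show ?thesis by (intro AE_not_summable_sublinear) (meson not_le)
qed

text \<open>A present colour with bounded count rests at a final level of at least 1. Its sojourn
  series there converges by \<open>AE_stuck\<close>, yet from some index on it coincides with the
  divergent clock.\<close>

lemma AE_all_unbounded:
  assumes ns: "\<not> summable (\<lambda>k. 1 / wt (Suc k))"
  shows "AE \<omega> in M. \<forall>c n. c \<in> set (hist n \<omega>) \<longrightarrow> \<not> bounded_count c \<omega>"
  using AE_not_summable_inverse_W[OF ns] AE_stuck
proof eventually_elim
  case (elim \<omega>)
  show ?case
  proof (intro allI impI notI)
    fix c n assume c: "c \<in> set (hist n \<omega>)" and b: "bounded_count c \<omega>"
    obtain k where k: "\<forall>\<^sub>F m in sequentially. hist_count (hist m \<omega>) c = k"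
      using bounded_count_eventually_const[OF b] .
    from eventually_happens'[OF sequentially_bot eventually_conj[OF k eventually_ge_at_top[of n]]]
    obtain m where m: "hist_count (hist m \<omega>) c = k" "n \<le> m" by blast
    have "1 \<le> k" using hist_count_hist_mono[OF m(2), of \<omega> c] m(1) c hist_count_pos_iff[of "hist n \<omega>" c] by simp
    then have "summable (\<lambda>n. of_bool (hist_count (hist (Suc n) \<omega>) c = k) / W (hist (Suc n) \<omega>))"
      using elim(2) by blast
    moreover have ev: "\<forall>\<^sub>F n in sequentially. of_bool (hist_count (hist (Suc n) \<omega>) c = k) / W (hist (Suc n) \<omega>) = 1 / W (hist (Suc n) \<omega>)"
      using eventually_sequentially_Suc[THEN iffD2, OF k] by eventually_elim simp
    ultimately have "summable (\<lambda>n. 1 / W (hist (Suc n) \<omega>))"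
      by (simp only: summable_cong[OF ev])
    then show False using elim(1) by simp
  qed
qed

end

theorem theorem3p2:
  fixes M :: "'a measure"
    and B :: "nat \<Rightarrow> 'a \<Rightarrow> bool"
    and S :: "nat \<Rightarrow> 'a \<Rightarrow> nat"
    and p :: "nat \<Rightarrow> real"
    and F :: "real \<Rightarrow> real"
    and q :: real
  assumes M: "prob_space M"
    and B_meas: "\<And>n. B n \<in> measurable M (count_space UNIV)"
    and S_meas: "\<And>n. S n \<in> measurable M (count_space UNIV)"
    and p_range: "\<And>n. n \<ge> 1 \<Longrightarrow> 0 < p n \<and> p n < 1"
    and q_lt1: "q < 1"
    and p_le_q: "\<And>n. n \<ge> 1 \<Longrightarrow> p n \<le> q"
    and F_mono: "strict_mono_on {1..} F"
    and F_nonneg: "\<And>x. x \<ge> 1 \<Longrightarrow> F x \<ge> 0"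
    and F1: "F 1 > 0"
    and law: "\<And>n bs ss. length bs = Suc n \<Longrightarrow> length ss = n \<Longrightarrow>
       measure M {\<omega>\<in>space M. (\<forall>i\<le>n. B i \<omega> = bs ! i) \<and> (\<forall>i<n. S (Suc i) \<omega> = ss ! i)}
         = urn_prob p F bs ss"
  shows
    "(summable (\<lambda>n. 1 / F (real (Suc n))) \<longrightarrow>
       (AE \<omega> in M. \<exists>c. infinite {n. n \<ge> 1 \<and> S n \<omega> = c} \<and>
                     (\<forall>c'. c' \<noteq> c \<longrightarrow> finite {n. n \<ge> 1 \<and> S n \<omega> = c'})))
     \<and>
     (\<not> summable (\<lambda>n. 1 / F (real (Suc n))) \<longrightarrow>
       (AE \<omega> in M. \<forall>c. 1 \<le> c \<and> (\<exists>n. c \<le> urn_C B n \<omega>) \<longrightarrow>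
                     filterlim (\<lambda>n. urn_K S n c \<omega>) at_top sequentially))"
proof -
  interpret prob_space M by (rule M)
  interpret faq_urn M B S p F q
    by unfold_locales (fact B_meas S_meas p_range q_lt1 p_le_q F_mono F1 law)+
  have wt: "(\<lambda>n. 1 / F (real (Suc n))) = (\<lambda>n. 1 / wt (Suc n))" by (simp only: wt_def)
  show ?thesis
    unfolding wt
  proof (intro conjI impI)
    assume "summable (\<lambda>n. 1 / wt (Suc n))"
    from AE_unique_unbounded[OF this]
    show "AE \<omega> in M. \<exists>c. infinite {n. n \<ge> 1 \<and> S n \<omega> = c} \<and>
        (\<forall>c'. c' \<noteq> c \<longrightarrow> finite {n. n \<ge> 1 \<and> S n \<omega> = c'})"
      by eventually_elim (use infinite_occurrences_iff in blast)
  next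
    assume "\<not> summable (\<lambda>n. 1 / wt (Suc n))"
    from AE_all_unbounded[OF this] AE_urn_C AE_hist_in
    show "AE \<omega> in M. \<forall>c. 1 \<le> c \<and> (\<exists>n. c \<le> urn_C B n \<omega>) \<longrightarrow>
        filterlim (\<lambda>n. urn_K S n c \<omega>) at_top sequentially"
    proof eventually_elim
      case (elim \<omega>)
      show ?case
      proof (intro allI impI)
        fix c assume "1 \<le> c \<and> (\<exists>n. c \<le> urn_C B n \<omega>)"
        then obtain n where "1 \<le> c" "c \<le> card (set (hist n \<omega>))" using elim(2) by auto
        \<comment> \<open>Labels are consecutive, so the colours present at time n are exactly those
          from 1 up to their number.\<close>
        then have "c \<in> set (hist n \<omega>)" using set_hists elim(3) by (metis atLeastAtMost_iff)
        then have "\<not> bounded_count c \<omega>" using elim(1) by blast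
        from unbounded_count_at_top[OF this]
        show "filterlim (\<lambda>n. urn_K S n c \<omega>) at_top sequentially"
          unfolding urn_K_eq_hist_count .
      qed
    qed
  qed
qed

end
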